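(* Let $H$ be a separable complex Hilbert space with $\dim H=\infty$, and let $T$ be a bounded linear operator on $H$. If $\alpha\in\mathcal D_{\rm const}(T)$ and $\beta\in W_e(T)$, then $$t\alpha+(1-t)\beta\in\mathcal D_{\rm const}(T)\qquad\text{for all } t\in(0,1).$$ Consequently, for a separable complex Hilbert space $H$ of any dimension $1\le\dim H\le\infty$ and any bounded linear operator $T$ on $H$, the set $\mathcal D_{\rm const}(T)$ is convex.
   Context: For a separable complex Hilbert space $H$ with $\dim H=N$, $1\le N\le\infty$, and a bounded linear operator $T$ on $H$, $\mathcal D_{\rm const}(T)\subset\mathbb C$ denotes the set of all $\lambda\in\mathbb C$ for which there exists an orthonormal basis $(u_j)_{j=1}^N$ of $H$ with $\langle Tu_j,u_j\rangle=\lambda$ for all $j$. If $\dim H=\infty$, the essential numerical range $W_e(T)\subset\mathbb C$ is the set of all $\lambda\in\mathbb C$ for which there exists an orthonormal sequence $(u_j)_{j=1}^\infty$ in $H$ with $\lim_{j\to\infty}\langle Tu_j,u_j\rangle=\lambda$. The empty set is regarded as convex. *)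

theory Defs
  imports "HOL-Analysis.Analysis" "HOL-Library.Extended_Nat"
begin

text \<open>
  Complex inner product spaces and Hilbert spaces. The inner product is linear in its first argument.
  The real scalar multiplication and the norm underlying \<^class>\<open>real_normed_vector\<close> are tied to the
  complex structure.
\<close>

class complex_inner = real_normed_vector +
  fixes scaleC :: "complex \<Rightarrow> 'a \<Rightarrow> 'a"  (infixr \<open>*\<^sub>C\<close> 75)
    and cinner :: "'a \<Rightarrow> 'a \<Rightarrow> complex"
  assumes scaleC_add_right: "c *\<^sub>C (x + y) = c *\<^sub>C x + c *\<^sub>C y"
    and scaleC_add_left: "(c + d) *\<^sub>C x = c *\<^sub>C x + d *\<^sub>C x"
    and scaleC_scaleC: "c *\<^sub>C d *\<^sub>C x = (c * d) *\<^sub>C x"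
    and scaleC_one: "1 *\<^sub>C x = x"
    and scaleR_scaleC: "r *\<^sub>R x = complex_of_real r *\<^sub>C x"
    and cinner_commute: "cinner x y = cnj (cinner y x)"
    and cinner_add_left: "cinner (x + y) z = cinner x z + cinner y z"
    and cinner_scaleC_left: "cinner (c *\<^sub>C x) y = c * cinner x y"
    and cinner_ge_zero: "0 \<le> Re (cinner x x)"
    and cinner_eq_zero_iff: "cinner x x = 0 \<longleftrightarrow> x = 0"
    and norm_eq_sqrt_cinner: "norm x = sqrt (Re (cinner x x))"

class chilbert_space = complex_inner + complete_space

global_interpretation complex_vector:
  vector_space "scaleC :: complex \<Rightarrow> 'a \<Rightarrow> 'a::complex_inner"
  defines cspan = complex_vector.span
    and cdim = complex_vector.dim
  by unfold_locales
    (simp_all add: scaleC_add_right scaleC_add_left scaleC_scaleC scaleC_one)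

definition bounded_clinear :: "('a::complex_inner \<Rightarrow> 'a) \<Rightarrow> bool" where
  "bounded_clinear T \<longleftrightarrow> bounded_linear T \<and> (\<forall>c x. T (c *\<^sub>C x) = c *\<^sub>C T x)"

text \<open>
  All infinite dimensions are identified; \<^const>\<open>cdim\<close> alone would return 0 for them.
\<close>

definition hdim :: "'a::complex_inner itself \<Rightarrow> enat" where
  "hdim _ = (if \<exists>B::'a set. finite B \<and> cspan B = UNIV
             then enat (cdim (UNIV::'a set)) else \<infinity>)"

text \<open>A family is given by a function of which only the values on the index set matter.\<close>

definition orthonormal_family :: "nat set \<Rightarrow> (nat \<Rightarrow> 'a::complex_inner) \<Rightarrow> bool" where
  "orthonormal_family I u \<longleftrightarrow>
     (\<forall>i\<in>I. \<forall>j\<in>I. cinner (u i) (u j) = (if i = j then 1 else 0))"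

definition orthonormal_basis :: "nat set \<Rightarrow> (nat \<Rightarrow> 'a::complex_inner) \<Rightarrow> bool" where
  "orthonormal_basis I u \<longleftrightarrow> orthonormal_family I u \<and> closure (cspan (u ` I)) = UNIV"

definition D_const :: "('a::chilbert_space \<Rightarrow> 'a) \<Rightarrow> complex set" where
  "D_const T = {l. \<exists>u. orthonormal_basis {j. 1 \<le> j \<and> enat j \<le> hdim TYPE('a)} u \<and>
     (\<forall>j. 1 \<le> j \<and> enat j \<le> hdim TYPE('a) \<longrightarrow> cinner (T (u j)) (u j) = l)}"

text \<open>The essential numerical range, which is used for infinite-dimensional spaces only.\<close>

definition W_ess :: "('a::chilbert_space \<Rightarrow> 'a) \<Rightarrow> complex set" where
  "W_ess T = {l. \<exists>u. orthonormal_family {1..} u \<and>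
     (\<lambda>j. cinner (T (u j)) (u j)) \<longlonglongrightarrow> l}"

end

theory Submission
  imports Defs
begin

text \<open>
  After an affine change of the operator the target value is \<open>0\<close>, the given basis \<open>u\<close> has diagonal
  \<open>1\<close>, and \<open>- b < 0\<close> lies in the essential numerical range. A finite orthonormal set of zero trace can
  be rotated, within its span, to one with zero diagonal (repeated use of the two-dimensional
  Toeplitz-Hausdorff theorem). So it suffices to exhaust the algebraic span of \<open>u\<close> by finite-dimensional
  subspaces of zero trace: the span of \<open>u\<^sub>1, \<dots>, u\<^sub>n\<close> has trace \<open>n\<close>, and this must be cancelled exactly
  by an orthonormal set \<open>V\<close> in the algebraic span of the later \<open>u\<^sub>j\<close>. Many vectors with value close
  to \<open>- b\<close>, mixed with as many \<open>u\<^sub>j\<close>, give the real part. The small error in the imaginary part is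
  corrected by one more vector: the imaginary part of the quadratic form has zero diagonal on the tail
  and therefore either vanishes there or takes both signs. Working with finite linear combinations of
  the \<open>u\<^sub>j\<close> keeps the trace of each initial segment equal to \<open>n\<close>, which is why exact cancellation
  remains possible at every step.
  In finite dimension the trace determines the constant.
\<close>

section \<open>Complex inner products\<close>

lemma cinner_scaleC_right: "cinner x (c *\<^sub>C y) = cnj c * cinner x y"
  by (metis cinner_commute cinner_scaleC_left complex_cnj_cnj complex_cnj_mult)

lemma cinner_add_right: "cinner x (y + z) = cinner x y + cinner x z"
  by (metis cinner_add_left cinner_commute complex_cnj_add)

lemma scaleR_cinner_left: "cinner (r *\<^sub>R x) y = r *\<^sub>R cinner x y"
  by (simp add: scaleR_scaleC cinner_scaleC_left scaleR_conv_of_real)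

lemma scaleR_cinner_right: "cinner x (r *\<^sub>R y) = r *\<^sub>R cinner x y"
  by (simp add: scaleR_scaleC cinner_scaleC_right scaleR_conv_of_real)

lemma cinner_self_norm: "cinner x x = complex_of_real ((norm x)\<^sup>2)"
proof -
  have "Im (cinner x x) = 0"
    using arg_cong[OF cinner_commute[of x x], of Im] by simp
  then show ?thesis
    by (simp add: complex_eq_iff norm_eq_sqrt_cinner cinner_ge_zero)
qed

lemma cinner_self_eq_1_iff: "cinner x x = 1 \<longleftrightarrow> norm x = 1"
proof -
  have "cinner x x = 1 \<longleftrightarrow> (norm x)\<^sup>2 = 1"
    unfolding cinner_self_norm by (metis of_real_1 of_real_eq_iff)
  then show ?thesis
    by (metis norm_ge_zero one_power2 power2_eq_iff_nonneg zero_le_one)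
qed

lemma cinner_eq_0_commute: "cinner x y = 0 \<longleftrightarrow> cinner y x = 0"
  by (metis cinner_commute complex_cnj_zero)

lemma cinner_zero_left [simp]: "cinner 0 x = 0"
  using cinner_add_left[of 0 0 x] by simp

lemma cinner_zero_right [simp]: "cinner x 0 = 0"
  using cinner_add_right[of x 0 0] by simp

lemma cinner_minus_left [simp]: "cinner (- x) y = - cinner x y"
  using cinner_add_left[of x "- x" y] by (simp add: add_eq_0_iff)

lemma cinner_minus_right [simp]: "cinner x (- y) = - cinner x y"
  using cinner_add_right[of x y "- y"] by (simp add: add_eq_0_iff)

lemma cinner_diff_left: "cinner (x - y) z = cinner x z - cinner y z"
  using cinner_add_left[of x "- y" z] by simp

lemma cinner_diff_right: "cinner x (y - z) = cinner x y - cinner x z"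
  using cinner_add_right[of x y "- z"] by simp

text \<open>Cauchy-Schwarz: the component of \<open>x\<close> orthogonal to \<open>y\<close> has a
  nonnegative square norm, and computing it gives the squared inequality divided by the square of
  \<open>norm y\<close>.\<close>

lemma norm_cinner_le: "cmod (cinner x y) \<le> norm x * norm y"
proof (cases "y = 0")
  case False
  define c where "c = cinner x y / cinner y y"
  have ny: "(norm y)\<^sup>2 > 0" using False by simp
  have orth: "cinner (x - c *\<^sub>C y) y = 0"
    using False by (simp add: cinner_diff_left cinner_scaleC_left c_def cinner_eq_zero_iff)
  have "cinner (x - c *\<^sub>C y) (x - c *\<^sub>C y) = cinner (x - c *\<^sub>C y) x"
    using orth by (simp add: cinner_diff_right cinner_scaleC_right)
  also have "\<dots> = cinner x x - c * cnj (cinner x y)"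
    by (simp add: cinner_diff_left cinner_scaleC_left cinner_commute[of y x])
  also have "\<dots> = complex_of_real ((norm x)\<^sup>2 - (cmod (cinner x y))\<^sup>2 / (norm y)\<^sup>2)"
    by (simp add: c_def cinner_self_norm complex_norm_square del: of_real_power)
  finally have "0 \<le> (norm x)\<^sup>2 - (cmod (cinner x y))\<^sup>2 / (norm y)\<^sup>2"
    using cinner_ge_zero[of "x - c *\<^sub>C y"] by (metis Re_complex_of_real)
  then have "(cmod (cinner x y))\<^sup>2 \<le> (norm x * norm y)\<^sup>2"
    using ny by (simp add: field_simps power_mult_distrib)
  then show ?thesis
    by (rule power2_le_imp_le) simp
qed simp

text \<open>Viewed as a real bilinear map, the inner product inherits the general rules for finite
  sums, limits and continuity.\<close>

interpretation cinner: bounded_bilinear "cinner :: 'a::complex_inner \<Rightarrow> 'a \<Rightarrow> complex"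
proof
  show "\<exists>K. \<forall>a b::'a. norm (cinner a b) \<le> norm a * norm b * K"
    by (rule exI[of _ 1]) (simp add: norm_cinner_le)
qed (simp_all add: cinner_add_left cinner_add_right scaleR_cinner_left scaleR_cinner_right)

lemma norm_scaleC: "norm (c *\<^sub>C x) = cmod c * norm x"
proof -
  have "complex_of_real ((norm (c *\<^sub>C x))\<^sup>2) = (c * cnj c) * cinner x x"
    by (simp add: cinner_self_norm[symmetric] cinner_scaleC_left cinner_scaleC_right del: of_real_power)
  also have "\<dots> = complex_of_real ((cmod c * norm x)\<^sup>2)"
    by (simp add: cinner_self_norm complex_norm_square[symmetric] power_mult_distrib)
  finally have "(norm (c *\<^sub>C x))\<^sup>2 = (cmod c * norm x)\<^sup>2"
    using of_real_eq_iff by blast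
  then show ?thesis by simp
qed

lemma cinner_span_left_eq_0:
  assumes "x \<in> cspan A" "\<And>a. a \<in> A \<Longrightarrow> cinner a y = 0"
  shows "cinner x y = 0"
  using assms(1)
proof (induction rule: complex_vector.span_induct_alt)
  case (step c a x)
  then show ?case by (simp add: cinner_add_left cinner_scaleC_left assms(2))
qed simp

lemma cinner_span_eq_0:
  assumes "x \<in> cspan A" "y \<in> cspan B"
    and "\<And>a b. a \<in> A \<Longrightarrow> b \<in> B \<Longrightarrow> cinner a b = 0"
  shows "cinner x y = 0"
proof (rule cinner_span_left_eq_0[OF assms(1)])
  fix a assume "a \<in> A"
  have "cinner y a = 0"
    using assms(2) by (rule cinner_span_left_eq_0) (metis \<open>a \<in> A\<close> assms(3) cinner_eq_0_commute)
  then show "cinner a y = 0" by (simp add: cinner_eq_0_commute)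
qed

section \<open>Orthonormal sets\<close>

text \<open>Sets suit the argument better than families: changes of basis within a span and unions
  of orthogonal blocks need no indexing. Only the final basis is enumerated.\<close>

definition orthonormal_set :: "'a::complex_inner set \<Rightarrow> bool" where
  "orthonormal_set A \<longleftrightarrow> (\<forall>x\<in>A. \<forall>y\<in>A. cinner x y = (if x = y then 1 else 0))"

lemma orthonormal_set_empty [simp]: "orthonormal_set {}"
  by (simp add: orthonormal_set_def)

lemma orthonormal_set_subset: "orthonormal_set A \<Longrightarrow> B \<subseteq> A \<Longrightarrow> orthonormal_set B"
  unfolding orthonormal_set_def by blast

lemma orthonormal_set_insert:
  assumes "a \<notin> A"
  shows "orthonormal_set (insert a A) \<longleftrightarrow>
    orthonormal_set A \<and> cinner a a = 1 \<and> (\<forall>x\<in>A. cinner x a = 0)"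
proof -
  have "(\<forall>x\<in>A. cinner a x = 0) \<longleftrightarrow> (\<forall>x\<in>A. cinner x a = 0)"
    by (metis cinner_eq_0_commute)
  moreover have "a \<noteq> x" "x \<noteq> a" if "x \<in> A" for x
    using assms that by blast+
  ultimately show ?thesis
    unfolding orthonormal_set_def by auto
qed

lemma orthonormal_set_Un:
  assumes "orthonormal_set A" "orthonormal_set B"
    and "\<And>a b. a \<in> A \<Longrightarrow> b \<in> B \<Longrightarrow> cinner a b = 0"
  shows "orthonormal_set (A \<union> B)" "A \<inter> B = {}"
proof -
  show *: "A \<inter> B = {}"
    using assms by (force simp: orthonormal_set_def)
  show "orthonormal_set (A \<union> B)"
    unfolding orthonormal_set_def
  proof (intro ballI)
    fix x y assume xy: "x \<in> A \<union> B" "y \<in> A \<union> B"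
    consider "x \<in> A" "y \<in> A" | "x \<in> B" "y \<in> B" | "x \<in> A" "y \<in> B" | "x \<in> B" "y \<in> A"
      using xy by blast
    then show "cinner x y = (if x = y then 1 else 0)"
    proof cases
      case 3
      then show ?thesis using assms(3) * by auto
    next
      case 4
      then show ?thesis using assms(3)[of y x] * by (auto simp: cinner_eq_0_commute[of x y])
    qed (use assms(1,2) in \<open>auto simp: orthonormal_set_def\<close>)
  qed
qed

lemma orthonormal_set_Un_span:
  assumes "orthonormal_set A" "orthonormal_set B" "A \<subseteq> cspan X" "B \<subseteq> cspan Y"
    and "\<And>a b. a \<in> X \<Longrightarrow> b \<in> Y \<Longrightarrow> cinner a b = 0"
  shows "orthonormal_set (A \<union> B)" "A \<inter> B = {}"
proof -
  have "cinner a b = 0" if "a \<in> A" "b \<in> B" for a b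
    using that assms(3,4) by (blast intro: cinner_span_eq_0[OF _ _ assms(5)])
  from orthonormal_set_Un[OF assms(1,2) this]
  show "orthonormal_set (A \<union> B)" "A \<inter> B = {}" by blast+
qed

lemma orthonormal_family_image:
  assumes "orthonormal_family I u"
  shows "orthonormal_set (u ` I)" "inj_on u I"
proof -
  show inj: "inj_on u I"
    using assms unfolding orthonormal_family_def inj_on_def by (metis zero_neq_one)
  show "orthonormal_set (u ` I)"
    using assms inj unfolding orthonormal_family_def orthonormal_set_def inj_on_def by auto
qed

section \<open>Expansions, residuals and Gram-Schmidt completion\<close>

lemma orthonormal_expansion:
  assumes "finite A" "orthonormal_set A" "x \<in> cspan A"
  shows "(\<Sum>a\<in>A. cinner x a *\<^sub>C a) = x"
  using assms(3)
proof (induction rule: complex_vector.span_induct_alt)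
  case base
  show ?case by simp
next
  case (step c b x)
  have "(\<Sum>a\<in>A. cinner b a *\<^sub>C a) = (\<Sum>a\<in>A. if a = b then b else 0)"
    using assms(2) step(1) by (intro sum.cong) (auto simp: orthonormal_set_def scaleC_one)
  also have "\<dots> = b" using assms(1) step(1) by simp
  finally have "(\<Sum>a\<in>A. cinner b a *\<^sub>C a) = b" .
  then have "(\<Sum>a\<in>A. (c * cinner b a) *\<^sub>C a) = c *\<^sub>C b"
    by (metis (no_types, lifting) complex_vector.scale_sum_right scaleC_scaleC sum.cong)
  then show ?case
    using step(2)
    by (simp add: cinner_add_left cinner_scaleC_left scaleC_add_left sum.distrib)
qed

lemma orthonormal_residual_orthogonal:
  assumes "finite A" "orthonormal_set A" "b \<in> A"
  shows "cinner (x - (\<Sum>a\<in>A. cinner x a *\<^sub>C a)) b = 0"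
proof -
  have "cinner (\<Sum>a\<in>A. cinner x a *\<^sub>C a) b = (\<Sum>a\<in>A. if a = b then cinner x b else 0)"
    using assms(2,3) unfolding cinner.sum_left
    by (intro sum.cong) (auto simp: cinner_scaleC_left orthonormal_set_def)
  then show ?thesis using assms(1,3) by (simp add: cinner_diff_left)
qed

text \<open>The residual of any vector is orthogonal to the span, hence by continuity to its
  closure, hence to itself.\<close>

lemma orthonormal_dense_span:
  assumes "finite A" "orthonormal_set A" "closure (cspan A) = UNIV"
  shows "cspan A = UNIV"
proof -
  have "x \<in> cspan A" for x
  proof -
    define z where "z = x - (\<Sum>a\<in>A. cinner x a *\<^sub>C a)"
    have "cinner a z = 0" if "a \<in> A" for a
      using orthonormal_residual_orthogonal[OF assms(1,2) that] cinner_eq_0_commute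
      unfolding z_def by blast
    then have "cspan A \<subseteq> {y. cinner y z = 0}"
      using cinner_span_left_eq_0 by blast
    moreover have "closed {y. cinner y z = 0}"
      by (intro closed_Collect_eq cinner.continuous_on continuous_intros)
    ultimately have "z \<in> {y. cinner y z = 0}"
      using closure_minimal assms(3) by blast
    then have "x = (\<Sum>a\<in>A. cinner x a *\<^sub>C a)"
      by (simp add: cinner_eq_zero_iff z_def)
    also have "\<dots> \<in> cspan A"
      by (intro complex_vector.span_sum complex_vector.span_scale complex_vector.span_base)
    finally show ?thesis .
  qed
  then show ?thesis by blast
qed

lemma cspan_insert_cong: "cspan A = cspan B \<Longrightarrow> cspan (insert x A) = cspan (insert x B)"
  by (simp add: complex_vector.span_insert)

lemma cspan_Un_cong: "cspan A = cspan B \<Longrightarrow> cspan (A \<union> C) = cspan (B \<union> C)"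
  by (simp add: complex_vector.span_Un)

text \<open>Gram-Schmidt, one vector of \<open>Y\<close> at a time. The elements of \<open>A\<close>
  themselves are kept, not only their span, so that a zero diagonal reached on \<open>A\<close>
  survives the extension.\<close>

lemma orthonormal_completion:
  assumes "finite A" "orthonormal_set A" "finite Y"
  shows "\<exists>R. finite R \<and> A \<inter> R = {} \<and> orthonormal_set (A \<union> R) \<and> cspan (A \<union> R) = cspan (A \<union> Y)"
  using assms(3)
proof (induction Y)
  case empty
  show ?case using assms by (intro exI[of _ "{}"]) simp
next
  case (insert y Y)
  then obtain R where R: "finite R" "A \<inter> R = {}" "orthonormal_set (A \<union> R)"
    "cspan (A \<union> R) = cspan (A \<union> Y)" by blast
  have span_y: "cspan (A \<union> insert y Y) = cspan (insert y (A \<union> R))"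
    using cspan_insert_cong[OF R(4), of y] by simp
  show ?case
  proof (cases "y \<in> cspan (A \<union> R)")
    case True
    then show ?thesis
      using R span_y complex_vector.span_redundant by metis
  next
    case False
    define p where "p = (\<Sum>a\<in>A \<union> R. cinner y a *\<^sub>C a)"
    define c where "c = complex_of_real (inverse (norm (y - p)))"
    define z where "z = c *\<^sub>C (y - p)"
    have p: "p \<in> cspan (A \<union> R)" unfolding p_def
      by (intro complex_vector.span_sum complex_vector.span_scale complex_vector.span_base)
    with False have yp: "y \<noteq> p" by blast
    then have c: "c \<noteq> 0" by (simp add: c_def)
    have orth: "cinner x z = 0" if "x \<in> A \<union> R" for x
      using orthonormal_residual_orthogonal[of "A \<union> R" x y] that assms(1) R
      by (simp add: z_def p_def cinner_scaleC_right cinner_eq_0_commute[of x])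
    have "norm z = 1" using yp by (simp add: z_def c_def norm_scaleC norm_inverse)
    then have zz: "cinner z z = 1" by (simp add: cinner_self_eq_1_iff)
    have z: "z \<notin> A \<union> R" using orth zz by force
    have "cspan (insert z (A \<union> R)) = cspan (insert y (A \<union> R))"
    proof
      have "z \<in> cspan (insert y (A \<union> R))"
        unfolding z_def using p complex_vector.span_mono[of "A \<union> R" "insert y (A \<union> R)"]
        by (intro complex_vector.span_scale complex_vector.span_diff)
          (auto intro: complex_vector.span_base)
      then show "cspan (insert z (A \<union> R)) \<subseteq> cspan (insert y (A \<union> R))"
        by (intro complex_vector.span_minimal) (auto intro: complex_vector.span_base)
      have "y = inverse c *\<^sub>C z + p"
        using c by (simp add: z_def scaleC_scaleC scaleC_one)
      also have "\<dots> \<in> cspan (insert z (A \<union> R))"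
        using p complex_vector.span_mono[of "A \<union> R" "insert z (A \<union> R)"]
        by (intro complex_vector.span_scale complex_vector.span_add)
          (auto intro: complex_vector.span_base complex_vector.span_scale)
      finally show "cspan (insert y (A \<union> R)) \<subseteq> cspan (insert z (A \<union> R))"
        by (intro complex_vector.span_minimal) (auto intro: complex_vector.span_base)
    qed
    moreover have "orthonormal_set (insert z (A \<union> R))"
      using z R(3) zz orth by (simp add: orthonormal_set_insert)
    ultimately show ?thesis
      using R z span_y by (intro exI[of _ "insert z R"]) auto
  qed
qed

text \<open>Each element of an algebraic span uses only finitely many \<open>u i\<close>. For
  orthonormal \<open>u\<close>, everything spanned beyond the cutoff \<open>m\<close> is then
  orthogonal to \<open>A\<close>; the parameter \<open>k\<close> lets the cutoff be taken as late as
  desired.\<close>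

lemma finite_subset_span_cutoff:
  fixes u :: "nat \<Rightarrow> 'a::complex_inner"
  assumes "finite A" "A \<subseteq> cspan (u ` {n<..})"
  shows "\<exists>m\<ge>k. A \<subseteq> cspan (u ` {n<..m})"
  using assms
proof (induction A)
  case (insert a A)
  then obtain m where m: "m \<ge> k" "A \<subseteq> cspan (u ` {n<..m})" by auto
  from insert.prems have "a \<in> cspan (u ` {n<..})" by blast
  then have "\<exists>l. a \<in> cspan (u ` {n<..l})"
  proof (induction rule: complex_vector.span_induct_alt)
    case base
    then show ?case by (auto intro: complex_vector.span_zero)
  next
    case (step c x y)
    then obtain l i where l: "y \<in> cspan (u ` {n<..l})" "x = u i" "n < i" by auto
    have "y \<in> cspan (u ` {n<..max l i})"
      using l(1) complex_vector.span_mono[of "u ` {n<..l}" "u ` {n<..max l i}"] by force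
    moreover have "x \<in> cspan (u ` {n<..max l i})"
      using l by (intro complex_vector.span_base) auto
    ultimately show ?case
      by (blast intro: complex_vector.span_add complex_vector.span_scale)
  qed
  then obtain l where "a \<in> cspan (u ` {n<..l})" ..
  then show ?case
    using m complex_vector.span_mono[of "u ` {n<..l}" "u ` {n<..max l m}"]
      complex_vector.span_mono[of "u ` {n<..m}" "u ` {n<..max l m}"]
    by (intro exI[of _ "max l m"]) (force simp: image_mono)
qed auto

section \<open>Bessel's inequality and weak convergence to zero\<close>

lemma bessel_finite:
  assumes "finite A" "orthonormal_set A"
  shows "(\<Sum>a\<in>A. (cmod (cinner x a))\<^sup>2) \<le> (norm x)\<^sup>2"
proof -
  define p where "p = (\<Sum>a\<in>A. cinner x a *\<^sub>C a)"
  have "cinner (x - p) p = 0"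
    using assms unfolding p_def cinner.sum_right
    by (intro sum.neutral) (simp add: cinner_scaleC_right orthonormal_residual_orthogonal)
  then have "cinner (x - p) (x - p) = cinner (x - p) x"
    by (simp add: cinner_diff_right)
  also have "\<dots> = cinner x x - (\<Sum>a\<in>A. cinner x a * cnj (cinner x a))"
    unfolding cinner_diff_left p_def cinner.sum_left cinner_scaleC_left
    by (metis cinner_commute)
  also have "\<dots> = complex_of_real ((norm x)\<^sup>2 - (\<Sum>a\<in>A. (cmod (cinner x a))\<^sup>2))"
    by (simp add: cinner_self_norm complex_norm_square[symmetric])
  finally show ?thesis
    using cinner_ge_zero[of "x - p"] by (metis Re_complex_of_real diff_ge_0_iff_ge)
qed

lemma orthonormal_sequence_weakly_null:
  assumes "orthonormal_family {1..} x"
  shows "(\<lambda>j. cinner (x j) y) \<longlonglongrightarrow> 0"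
proof -
  \<comment> \<open>Bessel bounds all partial sums. The shift by \<open>Suc\<close> skips
    \<open>x 0\<close>, about which nothing is assumed.\<close>
  have "summable (\<lambda>j. (cmod (cinner y (x (Suc j))))\<^sup>2)"
  proof (rule bounded_imp_summable)
    fix n
    have "(\<Sum>j\<le>n. (cmod (cinner y (x (Suc j))))\<^sup>2) = (\<Sum>j\<in>{1..Suc n}. (cmod (cinner y (x j)))\<^sup>2)"
      by (rule sum.reindex_bij_witness[of _ "\<lambda>j. j - 1" Suc]) auto
    also have "\<dots> = (\<Sum>a\<in>x ` {1..Suc n}. (cmod (cinner y a))\<^sup>2)"
      by (rule sum.reindex_cong[OF inj_on_subset[OF orthonormal_family_image(2)[OF assms]], symmetric])
        auto
    also have "\<dots> \<le> (norm y)\<^sup>2"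
      using orthonormal_family_image(1)[OF assms]
      by (intro bessel_finite) (auto intro: orthonormal_set_subset)
    finally show "(\<Sum>j\<le>n. (cmod (cinner y (x (Suc j))))\<^sup>2) \<le> (norm y)\<^sup>2" .
  qed simp
  then have "(\<lambda>j. (cmod (cinner y (x (Suc j))))\<^sup>2) \<longlonglongrightarrow> 0"
    by (rule summable_LIMSEQ_zero)
  then have "(\<lambda>j. sqrt ((cmod (cinner y (x (Suc j))))\<^sup>2)) \<longlonglongrightarrow> sqrt 0"
    by (rule tendsto_real_sqrt)
  then have "(\<lambda>j. norm (cinner y (x j))) \<longlonglongrightarrow> 0"
    using LIMSEQ_imp_Suc[of "\<lambda>j. cmod (cinner y (x j))" 0] by simp
  then show ?thesis
    by (subst tendsto_norm_zero_iff[symmetric]) (simp add: cinner_commute[of "x _" y])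
qed


section \<open>The quadratic form of an operator\<close>

lemma unimodular_rotation: "\<exists>\<zeta>. cmod \<zeta> = 1 \<and> \<zeta> * z = complex_of_real (cmod z)"
proof (cases "z = 0")
  case False
  have "cnj z / of_real (cmod z) * z = complex_of_real (cmod z)"
    using False complex_norm_square[of z] by (simp add: field_simps power2_eq_square)
  moreover have "cmod (cnj z / of_real (cmod z)) = 1"
    using False by (simp add: norm_divide)
  ultimately show ?thesis by blast
qed (auto intro: exI[of _ 1])

locale bounded_operator =
  fixes T :: "'a::complex_inner \<Rightarrow> 'a"
  assumes bounded_clinear: "bounded_clinear T"
begin

lemma bounded_linear: "bounded_linear T"
  using bounded_clinear by (simp add: bounded_clinear_def)

lemma T_scaleC: "T (c *\<^sub>C x) = c *\<^sub>C T x"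
  using bounded_clinear by (simp add: bounded_clinear_def)

lemmas T_add = linear_add[OF bounded_linear.linear[OF bounded_linear]]
lemmas T_diff = linear_diff[OF bounded_linear.linear[OF bounded_linear]]
lemmas T_sum = linear_sum[OF bounded_linear.linear[OF bounded_linear]]
lemmas T_zero [simp] = linear_0[OF bounded_linear.linear[OF bounded_linear]]

text \<open>Summed over a finite orthonormal set, this quadratic form gives the trace of the
  compression of \<open>T\<close> to the span of the set.\<close>

definition qf :: "'a \<Rightarrow> complex" where
  "qf x = cinner (T x) x"

lemma qf_scaleC: "qf (c *\<^sub>C x) = (complex_of_real (cmod c))\<^sup>2 * qf x"
  by (simp add: qf_def T_scaleC cinner_scaleC_left cinner_scaleC_right complex_norm_square
      flip: of_real_power)

text \<open>Basis independence of the trace: expand each \<open>a\<close> in \<open>B\<close>,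
  exchange the two sums, and contract the expansion of each \<open>b\<close> in
  \<open>A\<close>.\<close>

lemma qf_sum_span_cong:
  assumes "finite A" "orthonormal_set A" "finite B" "orthonormal_set B" "cspan A = cspan B"
  shows "sum qf A = sum qf B"
proof -
  have a: "(\<Sum>b\<in>B. cinner a b *\<^sub>C b) = a" if "a \<in> A" for a
    using that assms by (intro orthonormal_expansion) (metis complex_vector.span_base)+
  have b: "(\<Sum>a\<in>A. cinner b a *\<^sub>C a) = b" if "b \<in> B" for b
    using that assms by (intro orthonormal_expansion) (metis complex_vector.span_base)+
  have "qf a = (\<Sum>b\<in>B. cinner b a * cinner (T a) b)" if "a \<in> A" for a
  proof -
    have "qf a = cinner (T a) (\<Sum>b\<in>B. cinner a b *\<^sub>C b)"
      using a[OF that] by (simp add: qf_def)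
    then show ?thesis
      by (simp add: cinner.sum_right cinner_scaleC_right flip: cinner_commute)
  qed
  then have "sum qf A = (\<Sum>a\<in>A. \<Sum>b\<in>B. cinner b a * cinner (T a) b)"
    by simp
  also have "\<dots> = (\<Sum>b\<in>B. \<Sum>a\<in>A. cinner b a * cinner (T a) b)"
    by (rule sum.swap)
  also have "\<dots> = (\<Sum>b\<in>B. cinner (T (\<Sum>a\<in>A. cinner b a *\<^sub>C a)) b)"
    by (simp add: T_sum T_scaleC cinner.sum_left cinner_scaleC_left)
  also have "\<dots> = sum qf B"
    using b by (simp add: qf_def)
  finally show ?thesis .
qed

text \<open>A plane rotation applied after multiplying \<open>y\<close> by the phase
  \<open>\<zeta>\<close>. The cross term \<open>k\<close> enters the two values with opposite signs,
  so their sum stays the trace, while \<open>\<zeta>\<close> remains free to steer the argument of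
  \<open>k\<close>.\<close>

lemma rotation:
  fixes c s :: real
  assumes xy: "cinner x x = 1" "cinner y y = 1" "cinner x y = 0"
    and cs: "c\<^sup>2 + s\<^sup>2 = 1" and \<zeta>: "cmod \<zeta> = 1"
  defines "f \<equiv> of_real c *\<^sub>C x + (of_real s * \<zeta>) *\<^sub>C y"
    and "g \<equiv> of_real (- s) *\<^sub>C x + (of_real c * \<zeta>) *\<^sub>C y"
    and "k \<equiv> cnj \<zeta> * cinner (T x) y + \<zeta> * cinner (T y) x"
  shows "cinner f f = 1" "cinner g g = 1" "cinner f g = 0" "cspan {f, g} = cspan {x, y}"
    "qf f = of_real (c\<^sup>2) * qf x + of_real (s\<^sup>2) * qf y + of_real (c * s) * k"
    "qf g = of_real (s\<^sup>2) * qf x + of_real (c\<^sup>2) * qf y - of_real (c * s) * k"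
proof -
  have yx: "cinner y x = 0" using xy(3) cinner_eq_0_commute by blast
  have \<zeta>': "\<zeta> * cnj \<zeta> = 1" using \<zeta> complex_norm_square[of \<zeta>] by simp
  have cs': "complex_of_real c * of_real c + of_real s * of_real s = 1"
    using arg_cong[OF cs, of complex_of_real] by (simp add: power2_eq_square)
  note simps = cinner_diff_left cinner_diff_right cinner_add_left cinner_add_right cinner_scaleC_left cinner_scaleC_right xy yx
  have "cinner f f = of_real c * of_real c + of_real s * of_real s * (\<zeta> * cnj \<zeta>)"
    by (simp add: f_def simps algebra_simps)
  then show "cinner f f = 1" using \<zeta>' cs' by simp
  have "cinner g g = of_real s * of_real s + of_real c * of_real c * (\<zeta> * cnj \<zeta>)"
    by (simp add: g_def simps algebra_simps)
  then show "cinner g g = 1" using \<zeta>' cs' by (simp add: add.commute)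
  have "cinner f g = - of_real c * of_real s + of_real c * of_real s * (\<zeta> * cnj \<zeta>)"
    by (simp add: f_def g_def simps algebra_simps)
  then show "cinner f g = 0" using \<zeta>' by simp
  have "qf f = of_real c * of_real c * qf x + of_real s * of_real s * (\<zeta> * cnj \<zeta>) * qf y
      + of_real (c * s) * k"
    by (simp add: f_def k_def qf_def T_add T_scaleC simps algebra_simps)
  then show "qf f = of_real (c\<^sup>2) * qf x + of_real (s\<^sup>2) * qf y + of_real (c * s) * k"
    using \<zeta>' by (simp add: power2_eq_square)
  have "qf g = of_real s * of_real s * qf x + of_real c * of_real c * (\<zeta> * cnj \<zeta>) * qf y
      - of_real (c * s) * k"
    by (simp add: g_def k_def qf_def T_add T_diff T_scaleC simps algebra_simps)
  then show "qf g = of_real (s\<^sup>2) * qf x + of_real (c\<^sup>2) * qf y - of_real (c * s) * k"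
    using \<zeta>' by (simp add: power2_eq_square)
  show "cspan {f, g} = cspan {x, y}"
  proof
    have "f \<in> cspan {x, y}" "g \<in> cspan {x, y}"
      unfolding f_def g_def
      by (intro complex_vector.span_add complex_vector.span_scale complex_vector.span_base; simp)+
    then show "cspan {f, g} \<subseteq> cspan {x, y}"
      by (intro complex_vector.span_minimal) auto
    \<comment> \<open>The inverse rotation recovers \<open>x\<close> and, once the phase is undone,
      \<open>y\<close>.\<close>
    have "of_real c *\<^sub>C f + of_real (- s) *\<^sub>C g
        = (of_real c * of_real c + of_real s * of_real s) *\<^sub>C x
          + (of_real c * of_real s * \<zeta> - of_real s * of_real c * \<zeta>) *\<^sub>C y"
      by (simp add: f_def g_def scaleC_add_right scaleC_add_left scaleC_scaleC
          complex_vector.scale_left_diff_distrib algebra_simps)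
    also have "\<dots> = x" using cs' by (simp add: scaleC_one)
    finally have x: "x = of_real c *\<^sub>C f + of_real (- s) *\<^sub>C g" by simp
    have "cnj \<zeta> *\<^sub>C (of_real s *\<^sub>C f + of_real c *\<^sub>C g)
        = ((\<zeta> * cnj \<zeta>) * (of_real c * of_real c + of_real s * of_real s)) *\<^sub>C y
          + (cnj \<zeta> * of_real c * of_real s - cnj \<zeta> * of_real s * of_real c) *\<^sub>C x"
      by (simp add: f_def g_def scaleC_add_right scaleC_add_left scaleC_scaleC
          complex_vector.scale_left_diff_distrib algebra_simps)
    also have "\<dots> = y" using cs' \<zeta>' by (simp add: scaleC_one)
    finally have y: "y = cnj \<zeta> *\<^sub>C (of_real s *\<^sub>C f + of_real c *\<^sub>C g)" by simp
    have "x \<in> cspan {f, g}"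
      unfolding x
      by (intro complex_vector.span_add complex_vector.span_scale complex_vector.span_base; simp)
    moreover have "y \<in> cspan {f, g}"
      unfolding y
      by (intro complex_vector.span_add complex_vector.span_scale complex_vector.span_base; simp)
    ultimately show "cspan {x, y} \<subseteq> cspan {f, g}"
      by (intro complex_vector.span_minimal) auto
  qed
qed

text \<open>Two-dimensional Toeplitz-Hausdorff. The partner \<open>g\<close> is recorded too, since
  later constructions must keep the whole plane and not only the vector \<open>f\<close>.\<close>

lemma qf_segment:
  assumes xy: "cinner x x = 1" "cinner y y = 1" "cinner x y = 0" and r: "0 \<le> r" "r \<le> 1"
  shows "\<exists>f g. cinner f f = 1 \<and> cinner g g = 1 \<and> cinner f g = 0 \<and> cspan {f, g} = cspan {x, y} \<and>
    qf f = of_real (1 - r) * qf x + of_real r * qf y"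
proof (cases "qf x = qf y")
  case True
  then show ?thesis
    using xy by (intro exI[of _ x] exI[of _ y]) (simp add: algebra_simps)
next
  case False
  \<comment> \<open>Choose the phase so that the cross term is a real multiple of \<^term>\<open>qf x - qf y\<close>;
    then all values of the rotated vectors lie on one line.\<close>
  define e where "e = qf x - qf y"
  have e: "e \<noteq> 0" using False by (simp add: e_def)
  define p q where "p = cinner (T x) y * cnj e" and "q = cinner (T y) x * cnj e"
  obtain \<zeta> where \<zeta>: "cmod \<zeta> = 1" "\<zeta> * (q - cnj p) = of_real (cmod (q - cnj p))"
    using unimodular_rotation by blast
  define k where "k = cnj \<zeta> * cinner (T x) y + \<zeta> * cinner (T y) x"
  define \<rho> where "\<rho> = Re (k * cnj e) / (cmod e)\<^sup>2"
  have "k * cnj e = cnj \<zeta> * p + \<zeta> * q"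
    by (simp add: k_def p_def q_def algebra_simps)
  \<comment> \<open>\<open>cnj \<zeta> * p\<close> and its conjugate have opposite imaginary parts,
    so only the product of \<open>\<zeta>\<close> with \<open>q - cnj p\<close> has to be made
    real.\<close>
  moreover have "Im (cnj \<zeta> * p + \<zeta> * q) = Im (\<zeta> * (q - cnj p))"
    by (simp add: algebra_simps)
  ultimately have "Im (k * cnj e) = 0"
    using \<zeta>(2) by simp
  then have "k * cnj e = of_real (Re (k * cnj e))"
    by (simp add: complex_eq_iff)
  then have "k * (e * cnj e) = of_real (Re (k * cnj e)) * e"
    by (simp add: algebra_simps)
  then have k: "k = of_real \<rho> * e"
    using e by (simp add: \<rho>_def complex_norm_square[symmetric] field_simps)
  \<comment> \<open>The left side is 1 at \<open>t = 0\<close> and 0 at \<open>t = pi / 2\<close>,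
    whatever \<open>\<rho>\<close> is, so every weight \<open>1 - r\<close> is attained.\<close>
  have "\<exists>t\<ge>0. t \<le> pi / 2 \<and> (cos t)\<^sup>2 + cos t * sin t * \<rho> = 1 - r"
    by (rule IVT2') (use r in \<open>auto intro!: continuous_intros\<close>)
  then obtain t where t: "(cos t)\<^sup>2 + cos t * sin t * \<rho> = 1 - r" by blast
  have cs: "(cos t)\<^sup>2 + (sin t)\<^sup>2 = 1" by simp
  define f where "f = of_real (cos t) *\<^sub>C x + (of_real (sin t) * \<zeta>) *\<^sub>C y"
  define g where "g = of_real (- sin t) *\<^sub>C x + (of_real (cos t) * \<zeta>) *\<^sub>C y"
  note rot = rotation[OF xy cs \<zeta>(1), folded f_def g_def k_def]
  have "qf f = of_real ((cos t)\<^sup>2) * qf x + of_real ((sin t)\<^sup>2) * qf y + of_real (cos t * sin t * \<rho>) * e"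
    using rot(5) by (simp add: k)
  also have "(sin t)\<^sup>2 = 1 - (cos t)\<^sup>2" using cs by linarith
  also have "of_real ((cos t)\<^sup>2) * qf x + of_real (1 - (cos t)\<^sup>2) * qf y + of_real (cos t * sin t * \<rho>) * e
      = qf y + of_real ((cos t)\<^sup>2 + cos t * sin t * \<rho>) * e"
    by (simp add: e_def algebra_simps)
  also have "\<dots> = of_real (1 - r) * qf x + of_real r * qf y"
    unfolding t by (simp add: e_def algebra_simps)
  finally show ?thesis using rot(1-4) by blast
qed

end

text \<open>The trace of the identity operator counts the basis vectors.\<close>

lemma orthonormal_set_card_cong:
  assumes "finite A" "orthonormal_set A" "finite B" "orthonormal_set B" "cspan A = cspan B"
  shows "card A = card B"
proof -
  interpret id: bounded_operator "\<lambda>x::'a. x"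
    by standard (simp add: bounded_clinear_def bounded_linear_ident)
  have "sum id.qf C = of_nat (card C)" if "orthonormal_set C" for C :: "'a set"
    using that by (simp add: id.qf_def orthonormal_set_def)
  then show ?thesis
    using id.qf_sum_span_cong[OF assms] assms(2,4) of_nat_eq_iff by metis
qed

section \<open>Redistributing the trace of a finite orthonormal set\<close>

context bounded_operator
begin

text \<open>Induction on \<open>A\<close>: a vector with the mean value of the old set is rotated
  against the new vector \<open>a\<close>. One result takes the new mean, the other joins the
  remaining vectors.\<close>

lemma ex_orthonormal_mean:
  assumes "finite A" "A \<noteq> {}" "orthonormal_set A"
  shows "\<exists>f B. finite B \<and> f \<notin> B \<and> orthonormal_set (insert f B) \<and> cspan (insert f B) = cspan A \<and>
    qf f = sum qf A / of_nat (card A)"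
  using assms
proof (induction A rule: finite_ne_induct)
  case (singleton a)
  then show ?case by (intro exI[of _ a] exI[of _ "{}"]) simp
next
  case (insert a A)
  have A: "orthonormal_set A" "cinner a a = 1" "\<And>x. x \<in> A \<Longrightarrow> cinner x a = 0"
    using insert.prems insert.hyps by (auto simp: orthonormal_set_insert)
  with insert.IH obtain f B where fB: "finite B" "f \<notin> B" "orthonormal_set (insert f B)"
    "cspan (insert f B) = cspan A" and qf: "qf f = sum qf A / of_nat (card A)"
    by blast
  have f: "cinner f f = 1" "orthonormal_set B" "\<And>b. b \<in> B \<Longrightarrow> cinner b f = 0"
    using fB by (auto simp: orthonormal_set_insert)
  have a: "cinner b a = 0" if "b \<in> insert f B" for b
    using that fB(4) A(3) by (metis cinner_span_left_eq_0 complex_vector.span_base)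
  define n where "n = real (card A)"
  \<comment> \<open>The mean of \<open>n\<close> values with weight \<open>n / (n + 1)\<close> and
    one further value with weight \<open>1 / (n + 1)\<close> combine to the mean of all
    \<open>n + 1\<close>.\<close>
  define r where "r = n / (n + 1)"
  have n: "n > 0" using insert.hyps by (simp add: n_def card_gt_0_iff)
  then have r: "0 \<le> r" "r \<le> 1" by (auto simp: r_def)
  obtain f' g' where fg: "cinner f' f' = 1" "cinner g' g' = 1" "cinner f' g' = 0"
    "cspan {f', g'} = cspan {a, f}" "qf f' = of_real (1 - r) * qf a + of_real r * qf f"
    using qf_segment[OF A(2) f(1) _ r] a[of f] by (metis cinner_eq_0_commute insertI1)
  have ne: "f' \<noteq> g'" using fg by auto
  have on: "orthonormal_set {f', g'}"
    using fg ne cinner_eq_0_commute[of f' g'] by (auto simp: orthonormal_set_def)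
  have orth: "cinner x b = 0" if "x \<in> {a, f}" "b \<in> B" for x b
    using that a f(3) by (auto simp: cinner_eq_0_commute[of _ b])
  have un: "orthonormal_set ({f', g'} \<union> B)" "{f', g'} \<inter> B = {}"
    using orthonormal_set_Un_span[OF on f(2) _ _ orth] fg(4)
      complex_vector.span_superset[of "{f', g'}"] complex_vector.span_superset[of B] by auto
  have "1 - r = 1 / (n + 1)" using n by (simp add: r_def field_simps)
  then have "qf f' = (qf a + sum qf A) / of_real (n + 1)"
    using fg(5) n unfolding qf by (simp add: r_def add_divide_distrib) (simp add: n_def)
  also have "\<dots> = sum qf (insert a A) / of_nat (card (insert a A))"
    using insert.hyps by (simp add: n_def add.commute)
  finally have "qf f' = sum qf (insert a A) / of_nat (card (insert a A))" .
  moreover have "cspan ({f', g'} \<union> B) = cspan (insert a A)"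
    using cspan_Un_cong[OF fg(4), of B] cspan_insert_cong[OF fB(4), of a] by simp
  ultimately show ?case
    using un ne fB(1) by (intro exI[of _ f'] exI[of _ "insert g' B"]) simp
qed

text \<open>The mean is zero, so one vector of value zero can be split off. By invariance of the
  trace the rest again has trace zero, with one element fewer.\<close>

lemma ex_orthonormal_zero_diagonal:
  assumes "finite A" "orthonormal_set A" "sum qf A = 0"
  shows "\<exists>B. finite B \<and> orthonormal_set B \<and> cspan B = cspan A \<and> (\<forall>b\<in>B. qf b = 0)"
  using assms
proof (induction "card A" arbitrary: A)
  case 0
  then show ?case by (intro exI[of _ "{}"]) simp
next
  case (Suc n)
  then have "A \<noteq> {}" by auto
  then obtain f B where B: "finite B" "f \<notin> B" "orthonormal_set (insert f B)"
    "cspan (insert f B) = cspan A" and f: "qf f = 0"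
    using ex_orthonormal_mean[of A] Suc.prems by auto
  have on: "orthonormal_set B" "cinner f f = 1" "\<And>b. b \<in> B \<Longrightarrow> cinner b f = 0"
    using B by (auto simp: orthonormal_set_insert)
  have "card (insert f B) = card A"
    using B Suc.prems by (intro orthonormal_set_card_cong) auto
  then have "n = card B" using B Suc.hyps(2) by simp
  moreover have "sum qf (insert f B) = 0"
    using qf_sum_span_cong[of "insert f B" A] B Suc.prems by simp
  then have "sum qf B = 0" using B f by simp
  ultimately obtain C where C: "finite C" "orthonormal_set C" "cspan C = cspan B" "\<forall>c\<in>C. qf c = 0"
    using Suc.hyps(1)[of B] B(1) on(1) by blast
  have orth: "cinner c f = 0" if "c \<in> C" for c
    using that C(3) on(3) by (metis cinner_span_left_eq_0 complex_vector.span_base)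
  then have "f \<notin> C" using on(2) by force
  then have "orthonormal_set (insert f C)"
    using C on orth by (simp add: orthonormal_set_insert)
  moreover have "cspan (insert f C) = cspan A"
    using cspan_insert_cong[OF C(3)] B(4) by simp
  ultimately show ?case using C f by (intro exI[of _ "insert f C"]) auto
qed

text \<open>Pair the elements of \<open>A\<close> with those of \<open>B\<close> and choose one
  vector in each plane, with the same ratio \<open>r\<close>. Distinct planes are orthogonal, so the
  choices form an orthonormal set.\<close>

lemma ex_orthonormal_mixture:
  assumes "finite A" "finite B" "card A = card B" "orthonormal_set (A \<union> B)" "A \<inter> B = {}"
    and r: "0 \<le> r" "r \<le> 1"
  shows "\<exists>C. finite C \<and> orthonormal_set C \<and> C \<subseteq> cspan (A \<union> B) \<and>
    sum qf C = of_real (1 - r) * sum qf A + of_real r * sum qf B"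
  using assms(1-5)
proof (induction A arbitrary: B)
  case empty
  then show ?case by (intro exI[of _ "{}"]) simp
next
  case (insert a A)
  then obtain b B' where B: "B = insert b B'" "b \<notin> B'" "card B' = card A" "finite B'"
    by (metis card_Suc_eq_finite card_insert_disjoint)
  have dis: "A \<inter> B' = {}" "a \<noteq> b" "a \<notin> B'" "b \<notin> A"
    using insert.prems B by auto
  have on: "orthonormal_set (A \<union> B')" "orthonormal_set {a, b}"
    by (rule orthonormal_set_subset[OF insert.prems(3)], use B in auto)+
  obtain C where C: "finite C" "orthonormal_set C" "C \<subseteq> cspan (A \<union> B')"
    "sum qf C = of_real (1 - r) * sum qf A + of_real r * sum qf B'"
    using insert.IH[of B'] B on dis by metis
  obtain f where f: "cinner f f = 1" "f \<in> cspan {a, b}"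
    "qf f = of_real (1 - r) * qf a + of_real r * qf b"
  proof -
    have "cinner a a = 1" "cinner b b = 1" "cinner a b = 0"
      using on(2) dis by (auto simp: orthonormal_set_def)
    from qf_segment[OF this r] that show ?thesis
      by (metis complex_vector.span_base insertI1)
  qed
  have orth: "cinner x y = 0" if "x \<in> {a, b}" "y \<in> A \<union> B'" for x y
    using that insert.prems(3) insert.hyps(2) dis B unfolding orthonormal_set_def by auto
  have un: "orthonormal_set ({f} \<union> C)" "{f} \<inter> C = {}"
    using orthonormal_set_Un_span[of "{f}" C "{a, b}" "A \<union> B'", OF _ C(2) _ C(3) orth] f
    by (simp_all add: orthonormal_set_def)
  have "{f} \<union> C \<subseteq> cspan (insert a A \<union> B)"
    using f(2) C(3) complex_vector.span_mono[of "{a, b}" "insert a A \<union> B"]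
      complex_vector.span_mono[of "A \<union> B'" "insert a A \<union> B"] B(1) by blast
  moreover have "sum qf ({f} \<union> C) = of_real (1 - r) * sum qf (insert a A) + of_real r * sum qf B"
    using un(2) C f insert.hyps B by (simp add: algebra_simps)
  ultimately show ?case using un C(1) by (intro exI[of _ "{f} \<union> C"]) blast
qed

end


section \<open>Zero diagonals from a diagonal equal to one\<close>

text \<open>
  The parameter \<open>s\<close> cancels the imaginary part for each \<open>r\<close>; if all imaginary parts vanish, division by
  zero makes it \<open>0\<close>. The intermediate value theorem in \<open>r\<close> then gives the real part.
\<close>

lemma solve_mixture:
  fixes p1 p2 \<sigma> :: complex and m \<tau> K :: real
  assumes K: "cmod p1 \<le> K" "cmod p2 \<le> K" "K + \<bar>\<tau>\<bar> \<le> m" "Re \<sigma> \<le> - K - \<bar>\<tau>\<bar>"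
    and im: "Im p1 < 0 \<and> 0 < Im p2 \<and> \<bar>Im \<sigma>\<bar> \<le> - Im p1 \<and> \<bar>Im \<sigma>\<bar> \<le> Im p2
      \<or> Im p1 = 0 \<and> Im p2 = 0 \<and> Im \<sigma> = 0"
  shows "\<exists>s r. 0 \<le> s \<and> s \<le> 1 \<and> 0 \<le> r \<and> r \<le> 1 \<and>
    of_real (1 - s) * p1 + of_real s * p2 + (of_real (1 - r) * of_real m + of_real r * \<sigma>)
      = complex_of_real \<tau>"
proof -
  define s where "s r = (- Im p1 - r * Im \<sigma>) / (Im p2 - Im p1)" for r
  have s: "0 \<le> s r \<and> s r \<le> 1 \<and> (1 - s r) * Im p1 + s r * Im p2 + r * Im \<sigma> = 0"
    if "0 \<le> r" "r \<le> 1" for r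
    using im
  proof
    assume *: "Im p1 < 0 \<and> 0 < Im p2 \<and> \<bar>Im \<sigma>\<bar> \<le> - Im p1 \<and> \<bar>Im \<sigma>\<bar> \<le> Im p2"
    have "\<bar>r * Im \<sigma>\<bar> \<le> 1 * \<bar>Im \<sigma>\<bar>"
      unfolding abs_mult using that by (intro mult_right_mono) auto
    then have "\<bar>r * Im \<sigma>\<bar> \<le> - Im p1" "\<bar>r * Im \<sigma>\<bar> \<le> Im p2" using * by auto
    moreover have "Im p2 - Im p1 > 0" using * by simp
    moreover have "s r * (Im p2 - Im p1) = - Im p1 - r * Im \<sigma>"
      using \<open>Im p2 - Im p1 > 0\<close> by (simp add: s_def)
    moreover have "0 \<le> s r" "s r \<le> 1"
      using calculation unfolding s_def by (auto simp: divide_le_eq)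
    ultimately show ?thesis
      by (simp add: algebra_simps)
  qed (simp add: s_def)
  define F where "F r = (1 - s r) * Re p1 + s r * Re p2 + ((1 - r) * m + r * Re \<sigma>)" for r
  have conv: "\<bar>(1 - s r) * Re p1 + s r * Re p2\<bar> \<le> K" if "0 \<le> r" "r \<le> 1" for r
  proof -
    have "\<bar>Re p1\<bar> \<le> K" "\<bar>Re p2\<bar> \<le> K"
      using K abs_Re_le_cmod order_trans by blast+
    then have "\<bar>(1 - s r) * Re p1\<bar> \<le> (1 - s r) * K" "\<bar>s r * Re p2\<bar> \<le> s r * K"
      using s[OF that] by (auto simp: abs_mult intro: mult_left_mono)
    then show ?thesis by (simp add: algebra_simps)
  qed
  \<comment> \<open>The contribution of \<open>p1\<close> and \<open>p2\<close> stays within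
    \<open>K\<close>. At \<open>r = 0\<close> it is outweighed by \<open>m\<close>, at
    \<open>r = 1\<close> by \<open>Re \<sigma>\<close>, with \<open>\<tau>\<close> in
    between.\<close>
  have "\<exists>r\<ge>0. r \<le> 1 \<and> F r = \<tau>"
  proof (rule IVT2')
    show "F 1 \<le> \<tau>" using conv[of 1] K by (simp add: F_def)
    show "\<tau> \<le> F 0" using conv[of 0] K by (simp add: F_def)
    \<comment> \<open>The denominator in \<open>s\<close> does not depend on \<open>r\<close>, so
      continuity holds even where it is zero.\<close>
    show "continuous_on {0..1} F"
      unfolding F_def s_def divide_inverse by (intro continuous_intros)
  qed simp
  then obtain r where r: "0 \<le> r" "r \<le> 1" "F r = \<tau>" by blast
  then show ?thesis
    using s[of r] by (intro exI[of _ "s r"] exI[of _ r]) (simp add: complex_eq_iff F_def)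
qed

text \<open>The residual map is linear, kills \<open>u i\<close> for \<open>i \<le> n\<close> and
  fixes \<open>u i\<close> for \<open>i > n\<close>.\<close>

lemma orthonormal_residual_in_tail:
  fixes u :: "nat \<Rightarrow> 'a::complex_inner"
  assumes u: "orthonormal_family {0<..} u" and y: "y \<in> cspan (u ` {0<..})"
  shows "y - (\<Sum>a\<in>u ` {0<..n}. cinner y a *\<^sub>C a) \<in> cspan (u ` {n<..})"
  using y
proof (induction rule: complex_vector.span_induct_alt)
  case base
  then show ?case by (simp add: complex_vector.span_zero)
next
  case (step c b y)
  define P where "P y = (\<Sum>a\<in>u ` {0<..n}. cinner y a *\<^sub>C a)" for y
  have on: "orthonormal_set (u ` {0<..n})"
    using orthonormal_family_image(1)[OF u] by (rule orthonormal_set_subset) auto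
  obtain i where i: "b = u i" "0 < i" using step(1) by auto
  have "b - P b \<in> cspan (u ` {n<..})"
  proof (cases "i \<le> n")
    case True
    then have "P b = b" unfolding P_def
      using i on by (intro orthonormal_expansion) (auto intro: complex_vector.span_base)
    then show ?thesis by (simp add: complex_vector.span_zero)
  next
    case False
    have "P b = 0" unfolding P_def
      using False i u by (intro sum.neutral) (auto simp: orthonormal_family_def)
    then show ?thesis using False i by (auto intro: complex_vector.span_base)
  qed
  moreover have "c *\<^sub>C b + y - P (c *\<^sub>C b + y) = c *\<^sub>C (b - P b) + (y - P y)"
    by (simp add: P_def cinner_add_left cinner_scaleC_left scaleC_add_left sum.distrib
        complex_vector.scale_sum_right complex_vector.scale_right_diff_distrib)
  ultimately show ?case
    using step(2) unfolding P_def[symmetric]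
    by (metis complex_vector.span_add complex_vector.span_scale)
qed

section \<open>The normalised operator and the tails of its basis\<close>

locale unit_diagonal_operator = bounded_operator T for T :: "'a::complex_inner \<Rightarrow> 'a" +
  fixes u x :: "nat \<Rightarrow> 'a" and b :: real
  assumes u: "orthonormal_basis {0<..} u" and qf_u: "\<And>j. 0 < j \<Longrightarrow> qf (u j) = 1"
    and x: "orthonormal_family {1..} x" and qf_x: "(\<lambda>j. qf (x j)) \<longlonglongrightarrow> - of_real b"
    and b: "0 < b"
begin

text \<open>The span is deliberately not closed: finitely many of its elements always leave a
  further tail orthogonal to them.\<close>

definition tail :: "nat \<Rightarrow> 'a set" where
  "tail n = cspan (u ` {n<..})"

lemma orthonormal_u: "orthonormal_family {0<..} u"
  using u by (simp add: orthonormal_basis_def)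

lemma orthonormal_set_u: "orthonormal_set (u ` {m<..n})"
  using orthonormal_family_image(1)[OF orthonormal_u] by (rule orthonormal_set_subset) auto

lemma inj_on_u: "inj_on u {0<..}"
  using orthonormal_family_image(2)[OF orthonormal_u] .

lemma card_u: "card (u ` {m<..n}) = n - m"
  by (subst card_image[OF inj_on_subset[OF inj_on_u]]) auto

lemma sum_qf_u: "sum qf (u ` {m<..n}) = of_nat (n - m)"
proof -
  have "sum qf (u ` {m<..n}) = (\<Sum>a\<in>u ` {m<..n}. 1)"
    using qf_u by (intro sum.cong) auto
  then show ?thesis using card_u[of m n] by simp
qed

lemma cinner_u: "0 < i \<Longrightarrow> 0 < j \<Longrightarrow> cinner (u i) (u j) = (if i = j then 1 else 0)"
  using orthonormal_u by (simp add: orthonormal_family_def)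

text \<open>Approximate \<open>x j\<close> in the algebraic span, remove the first \<open>n\<close>
  coordinates and normalise. For large \<open>j\<close> all three changes are small, the second
  because an orthonormal sequence is weakly null.\<close>

lemma ex_tail_vector_near:
  assumes "0 < \<epsilon>"
  shows "\<exists>v\<in>tail n. cinner v v = 1 \<and> cmod (qf v + of_real b) < \<epsilon>"
proof -
  have "\<exists>y\<in>cspan (u ` {0<..}). dist y (x j) < inverse (real (Suc j))" for j
    using u by (intro closure_approachable[THEN iffD1, rule_format])
      (auto simp: orthonormal_basis_def)
  then obtain y where y: "\<And>j. y j \<in> cspan (u ` {0<..})"
    and yx: "\<And>j. dist (y j) (x j) < inverse (real (Suc j))" by metis
  define P where "P y = (\<Sum>a\<in>u ` {0<..n}. cinner y a *\<^sub>C a)" for y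
  define z where "z j = y j - P (y j)" for j
  define d where "d j = z j - x j" for j
  have z: "z j \<in> tail n" for j
    using orthonormal_residual_in_tail[OF orthonormal_u y] by (simp add: tail_def z_def P_def)
  have yx0: "(\<lambda>j. y j - x j) \<longlonglongrightarrow> 0"
    by (rule Lim_null_comparison[OF _ LIMSEQ_inverse_real_of_nat])
      (use yx in \<open>auto simp: dist_norm intro!: always_eventually less_imp_le\<close>)
  have "(\<lambda>j. cinner (y j) a *\<^sub>C a) \<longlonglongrightarrow> 0" for a
  proof -
    have "(\<lambda>j. cinner (y j - x j) a + cinner (x j) a) \<longlonglongrightarrow> cinner 0 a + 0"
      by (intro tendsto_add cinner.tendsto yx0 tendsto_const orthonormal_sequence_weakly_null[OF x])
    then have "(\<lambda>j. cinner (y j) a) \<longlonglongrightarrow> 0" by (simp add: cinner_diff_left)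
    then have "(\<lambda>j. cmod (cinner (y j) a) * norm a) \<longlonglongrightarrow> 0"
      by (intro tendsto_mult_left_zero tendsto_norm_zero)
    then show ?thesis by (subst tendsto_norm_zero_iff[symmetric]) (simp add: norm_scaleC)
  qed
  then have "(\<lambda>j. P (y j)) \<longlonglongrightarrow> 0" unfolding P_def by (rule tendsto_null_sum)
  from tendsto_diff[OF yx0 this] have "(\<lambda>j. y j - x j - P (y j)) \<longlonglongrightarrow> 0"
    by simp
  moreover have "d = (\<lambda>j. y j - x j - P (y j))"
    by (simp add: fun_eq_iff d_def z_def)
  ultimately have d: "d \<longlonglongrightarrow> 0" by simp
  have nx: "norm (x j) = 1" if "j \<ge> 1" for j
    using x that by (simp add: orthonormal_family_def cinner_self_eq_1_iff[symmetric])
  have "(\<lambda>j. norm (z j) - 1) \<longlonglongrightarrow> 0"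
  proof (rule Lim_null_comparison[OF _ tendsto_norm_zero[OF d]])
    show "\<forall>\<^sub>F j in sequentially. norm (norm (z j) - 1) \<le> norm (d j)"
      using eventually_ge_at_top[of 1]
    proof eventually_elim
      case (elim j)
      then show ?case
        using norm_triangle_ineq3[of "z j" "x j"] nx[of j] by (simp add: d_def)
    qed
  qed
  then have nz: "(\<lambda>j. norm (z j)) \<longlonglongrightarrow> 1" by (simp add: LIM_zero_iff)
  obtain K where K: "\<And>x. norm (T x) \<le> norm x * K"
    using bounded_linear.bounded[OF bounded_linear] by blast
  have Td: "(\<lambda>j. T (d j)) \<longlonglongrightarrow> 0"
    using bounded_linear.tendsto[OF bounded_linear d] by simp
  have t1: "(\<lambda>j. cinner (T (d j)) (x j)) \<longlonglongrightarrow> 0"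
  proof (rule Lim_null_comparison[OF _ tendsto_norm_zero[OF Td]])
    show "\<forall>\<^sub>F j in sequentially. cmod (cinner (T (d j)) (x j)) \<le> norm (T (d j))"
      using eventually_ge_at_top[of 1]
    proof eventually_elim
      case (elim j)
      then show ?case using norm_cinner_le[of "T (d j)" "x j"] nx by simp
    qed
  qed
  have t2: "(\<lambda>j. cinner (T (x j)) (d j)) \<longlonglongrightarrow> 0"
  proof (rule Lim_null_comparison)
    show "(\<lambda>j. K * norm (d j)) \<longlonglongrightarrow> 0"
      by (intro tendsto_mult_right_zero tendsto_norm_zero d)
    show "\<forall>\<^sub>F j in sequentially. cmod (cinner (T (x j)) (d j)) \<le> K * norm (d j)"
      using eventually_ge_at_top[of 1]
    proof eventually_elim
      case (elim j)
      have "norm (T (x j)) * norm (d j) \<le> K * norm (d j)"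
        using K[of "x j"] nx[OF elim] by (intro mult_right_mono) auto
      then show ?case using norm_cinner_le order_trans by blast
    qed
  qed
  have t3: "(\<lambda>j. cinner (T (d j)) (d j)) \<longlonglongrightarrow> 0"
    using cinner.tendsto[OF Td d] by simp
  \<comment> \<open>Expanding around \<open>x j\<close> leaves three error terms, each with a factor
    tending to zero.\<close>
  have "qf (z j) = qf (x j) + cinner (T (d j)) (x j) + cinner (T (x j)) (d j) + cinner (T (d j)) (d j)" for j
  proof -
    have "z j = x j + d j" by (simp add: d_def)
    then show ?thesis
      by (simp only: qf_def T_add cinner_add_left cinner_add_right add_ac)
  qed
  then have "(\<lambda>j. qf (z j)) \<longlonglongrightarrow> - of_real b"
    using tendsto_add[OF tendsto_add[OF tendsto_add[OF qf_x t1] t2] t3] by simp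
  then have "(\<lambda>j. (complex_of_real (inverse (norm (z j))))\<^sup>2 * qf (z j) + of_real b)
      \<longlonglongrightarrow> (complex_of_real (inverse 1))\<^sup>2 * - of_real b + of_real b"
    by (intro tendsto_intros nz) auto
  then have "(\<lambda>j. (complex_of_real (inverse (norm (z j))))\<^sup>2 * qf (z j) + of_real b) \<longlonglongrightarrow> 0"
    by simp
  from tendstoD[OF this assms]
  have "\<forall>\<^sub>F j in sequentially.
      cmod ((complex_of_real (inverse (norm (z j))))\<^sup>2 * qf (z j) + of_real b) < \<epsilon>" by simp
  moreover have "\<forall>\<^sub>F j in sequentially. 0 < norm (z j)"
    using order_tendstoD(1)[OF nz, of 0] by simp
  ultimately obtain j
    where j: "cmod ((complex_of_real (inverse (norm (z j))))\<^sup>2 * qf (z j) + of_real b) < \<epsilon>"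
      "0 < norm (z j)"
    using eventually_happens[OF eventually_conj] by fastforce
  define v where "v = complex_of_real (inverse (norm (z j))) *\<^sub>C z j"
  have "v \<in> tail n"
    using z[of j] by (auto simp: v_def tail_def intro: complex_vector.span_scale)
  moreover have "cinner v v = 1"
    using j(2) by (simp add: cinner_self_eq_1_iff v_def norm_scaleC norm_inverse)
  moreover have "qf v = (complex_of_real (inverse (norm (z j))))\<^sup>2 * qf (z j)"
    by (simp add: v_def qf_scaleC norm_inverse del: of_real_inverse)
  ultimately show ?thesis using j(1) by auto
qed

section \<open>Orthogonal blocks in the tail with a prescribed trace\<close>

lemma cinner_tail_eq_0:
  assumes "y \<in> cspan (u ` {k<..m})" "z \<in> tail m"
  shows "cinner y z = 0"
  using assms unfolding tail_def
  by (rule cinner_span_eq_0) (auto simp: cinner_u)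

lemma orthonormal_set_Un_tail:
  assumes "orthonormal_set A" "orthonormal_set B" "A \<subseteq> cspan (u ` {k<..m})" "B \<subseteq> tail m"
  shows "orthonormal_set (A \<union> B)" "A \<inter> B = {}"
proof -
  have "cinner a c = 0" if "a \<in> A" "c \<in> B" for a c
    using that assms cinner_tail_eq_0 by blast
  from orthonormal_set_Un[OF assms(1,2) this]
  show "orthonormal_set (A \<union> B)" "A \<inter> B = {}" by blast+
qed

lemma tail_mono: "m \<le> n \<Longrightarrow> tail n \<subseteq> tail m"
  unfolding tail_def by (intro complex_vector.span_mono) auto

text \<open>Choose the vectors one after another, each in the tail beyond the cutoff of its
  predecessors; orthogonality is then automatic.\<close>

lemma ex_tail_set_near:
  assumes "0 < \<epsilon>"
  shows "\<exists>V. finite V \<and> card V = m \<and> orthonormal_set V \<and> V \<subseteq> tail n \<and>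
    (\<forall>v\<in>V. cmod (qf v + of_real b) < \<epsilon>)"
proof (induction m)
  case 0
  then show ?case by (intro exI[of _ "{}"]) simp
next
  case (Suc m)
  then obtain V where V: "finite V" "card V = m" "orthonormal_set V" "V \<subseteq> tail n"
    "\<forall>v\<in>V. cmod (qf v + of_real b) < \<epsilon>" by blast
  obtain k where k: "k \<ge> n" "V \<subseteq> cspan (u ` {n<..k})"
    using finite_subset_span_cutoff[OF V(1)] V(4) unfolding tail_def by blast
  obtain v where v: "v \<in> tail k" "cinner v v = 1" "cmod (qf v + of_real b) < \<epsilon>"
    using ex_tail_vector_near[OF assms] by blast
  have "orthonormal_set (V \<union> {v})" "V \<inter> {v} = {}"
    using orthonormal_set_Un_tail[OF V(3) _ k(2), of "{v}"] v by (auto simp: orthonormal_set_def)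
  then show ?case
    using V v tail_mono[OF k(1)] by (intro exI[of _ "insert v V"]) auto
qed

text \<open>
  The diagonal of the imaginary part of \<^term>\<open>T\<close> vanishes, so unless its compression to the tail
  is zero it has an off-diagonal entry, and rotating that pair by 45 degrees gives both signs.
\<close>

lemma ex_tail_pair:
  "\<exists>w1 w2. w1 \<in> tail n \<and> w2 \<in> tail n \<and> cinner w1 w1 = 1 \<and> cinner w2 w2 = 1 \<and> cinner w1 w2 = 0 \<and>
    (Im (qf w1) < 0 \<and> 0 < Im (qf w2) \<or> (\<forall>x\<in>tail n. Im (qf x) = 0))"
proof -
  \<comment> \<open>The sesquilinear form of \<open>T\<close> minus its adjoint; on the diagonal it
    equals \<open>2 * \<i> * Im (qf x)\<close>.\<close>
  define h where "h x y = cinner (T x) y - cnj (cinner (T y) x)" for x y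
  show ?thesis
  proof (cases "\<forall>i>n. \<forall>j>n. h (u i) (u j) = 0")
    case True
    have 1: "h x (u j) = 0" if "x \<in> tail n" "j > n" for x j
      using that(1) unfolding tail_def
    proof (induction rule: complex_vector.span_induct_alt)
      case (step c a x)
      then have "h a (u j) = 0" using True that(2) by auto
      then show ?case using step(2)
        by (simp add: h_def T_add T_scaleC cinner_add_left cinner_add_right cinner_scaleC_left
            cinner_scaleC_right algebra_simps)
    qed (simp add: h_def)
    have 2: "h x y = 0" if "x \<in> tail n" "y \<in> tail n" for x y
      using that(2) unfolding tail_def
    proof (induction rule: complex_vector.span_induct_alt)
      case (step c a y)
      then have "h x a = 0" using 1 that(1) by auto
      then show ?case using step(2)
        by (simp add: h_def T_add T_scaleC cinner_add_left cinner_add_right cinner_scaleC_left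
            cinner_scaleC_right algebra_simps)
    qed (simp add: h_def)
    have "Im (qf x) = 0" if "x \<in> tail n" for x
      using arg_cong[OF 2[OF that that], of Im] by (simp add: h_def qf_def)
    moreover have "u (n + 1) \<in> tail n" "u (n + 2) \<in> tail n"
      unfolding tail_def by (auto intro: complex_vector.span_base)
    ultimately show ?thesis
      by (intro exI[of _ "u (n + 1)"] exI[of _ "u (n + 2)"]) (simp add: cinner_u)
  next
    case False
    then obtain i j where ij: "i > n" "j > n" "h (u i) (u j) \<noteq> 0" by blast
    define \<eta> where "\<eta> = h (u i) (u j)"
    have "h (u k) (u k) = 0" if "k > n" for k
      using qf_u[of k] that by (simp add: h_def qf_def)
    then have "i \<noteq> j" using ij by metis
    obtain \<xi> where \<xi>: "cmod \<xi> = 1" "\<xi> * \<eta> = of_real (cmod \<eta>)"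
      using unimodular_rotation by blast
    \<comment> \<open>This phase turns \<open>\<eta>\<close> onto the positive imaginary axis:
      \<open>cnj \<zeta> * \<eta> = \<i> * cmod \<eta>\<close>.\<close>
    define \<zeta> where "\<zeta> = cnj (\<i> * \<xi>)"
    have \<zeta>: "cmod \<zeta> = 1" using \<xi>(1) by (simp add: \<zeta>_def norm_mult)
    define k where "k = cnj \<zeta> * cinner (T (u i)) (u j) + \<zeta> * cinner (T (u j)) (u i)"
    have "Im k = Im (cnj \<zeta> * \<eta>)"
      by (simp add: k_def \<eta>_def h_def algebra_simps)
    also have "\<dots> = cmod \<eta>"
      using \<xi>(2) by (simp add: \<zeta>_def mult.assoc)
    finally have k: "Im k > 0" using ij(3) by (simp add: \<eta>_def)
    \<comment> \<open>Equal weights and diagonal values 1 give \<open>qf f = 1 + k / 2\<close> and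
      \<open>qf g = 1 - k / 2\<close>.\<close>
    define c where "c = 1 / sqrt (2::real)"
    have c: "c\<^sup>2 = 1 / 2" by (simp add: c_def power_divide)
    then have cs: "c\<^sup>2 + c\<^sup>2 = 1" by simp
    have uij: "cinner (u i) (u i) = 1" "cinner (u j) (u j) = 1" "cinner (u i) (u j) = 0"
      using ij \<open>i \<noteq> j\<close> by (auto simp: cinner_u)
    define f where "f = of_real c *\<^sub>C u i + (of_real c * \<zeta>) *\<^sub>C u j"
    define g where "g = of_real (- c) *\<^sub>C u i + (of_real c * \<zeta>) *\<^sub>C u j"
    note rot = rotation[OF uij cs \<zeta>, folded f_def g_def k_def]
    have "c * c = 1 / 2" using c by (simp add: power2_eq_square)
    then have "Im (qf f) = Im k / 2" "Im (qf g) = - Im k / 2"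
      using rot(5,6) qf_u[of i] qf_u[of j] ij by simp_all
    moreover have "f \<in> tail n" "g \<in> tail n"
      using ij unfolding f_def g_def tail_def
      by (intro complex_vector.span_add complex_vector.span_scale complex_vector.span_base; simp)+
    moreover have "cinner g f = 0" using rot(3) cinner_eq_0_commute by blast
    ultimately show ?thesis
      using rot(1,2) k by (intro exI[of _ g] exI[of _ f]) simp
  qed
qed

text \<open>Three mutually orthogonal blocks are used: a pair that corrects the imaginary part, a
  set \<open>V\<close> with values near \<open>- b\<close>, and equally many basis vectors
  \<open>U\<close>. Mixing \<open>U\<close> with \<open>V\<close> sweeps the real part across
  \<open>\<tau>\<close>. The vector taken from the pair makes the result nonempty.\<close>

lemma ex_tail_set_sum:
  "\<exists>V. finite V \<and> V \<noteq> {} \<and> orthonormal_set V \<and> V \<subseteq> tail n \<and> sum qf V = of_real \<tau>"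
proof -
  obtain w1 w2 where w: "w1 \<in> tail n" "w2 \<in> tail n" "cinner w1 w1 = 1" "cinner w2 w2 = 1"
    "cinner w1 w2 = 0"
    and im: "Im (qf w1) < 0 \<and> 0 < Im (qf w2) \<or> (\<forall>x\<in>tail n. Im (qf x) = 0)"
    using ex_tail_pair[of n] by blast
  obtain k where k: "k \<ge> n" "{w1, w2} \<subseteq> cspan (u ` {n<..k})"
    using finite_subset_span_cutoff[of "{w1, w2}" u n n] w unfolding tail_def by auto
  define K where "K = cmod (qf w1) + cmod (qf w2)"
  \<comment> \<open>Both \<open>m\<close> values 1 and \<open>m\<close> real parts at most
    \<open>- b / 2\<close> must outweigh \<open>\<bar>\<tau>\<bar>\<close> plus the bound
    \<open>K\<close> for the pair.\<close>
  define m where "m = nat \<lceil>max (K + \<bar>\<tau>\<bar>) (2 * (K + \<bar>\<tau>\<bar>) / b)\<rceil>"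
  \<comment> \<open>The imaginary error which the pair can absorb. The default 1 applies when all
    imaginary parts on the tail vanish, and only keeps \<open>\<delta>\<close> positive.\<close>
  define \<delta> where "\<delta> = (if Im (qf w1) < 0 \<and> 0 < Im (qf w2) then min (- Im (qf w1)) (Im (qf w2)) else 1)"
  \<comment> \<open>The first bound keeps real parts in \<open>V\<close> below
    \<open>- b / 2\<close>; the second keeps the sum of \<open>m\<close> imaginary parts within
    \<open>\<delta>\<close>, with \<open>m + 1\<close> guarding against
    \<open>m = 0\<close>.\<close>
  define \<epsilon> where "\<epsilon> = min (b / 2) (\<delta> / (m + 1))"
  have \<delta>: "\<delta> > 0" by (auto simp: \<delta>_def)
  then have \<epsilon>: "\<epsilon> > 0" using b by (simp add: \<epsilon>_def)
  have "max (K + \<bar>\<tau>\<bar>) (2 * (K + \<bar>\<tau>\<bar>) / b) \<le> m"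
    unfolding m_def by (rule real_nat_ceiling_ge)
  then have m: "K + \<bar>\<tau>\<bar> \<le> m" "K + \<bar>\<tau>\<bar> \<le> m * b / 2"
    using b by (simp_all add: field_simps)
  obtain V where V: "finite V" "card V = m" "orthonormal_set V" "V \<subseteq> tail k"
    "\<And>v. v \<in> V \<Longrightarrow> cmod (qf v + of_real b) < \<epsilon>"
    using ex_tail_set_near[OF \<epsilon>] by metis
  obtain l where l: "l \<ge> k" "V \<subseteq> cspan (u ` {k<..l})"
    using finite_subset_span_cutoff[OF V(1)] V(4) unfolding tail_def by blast
  define U where "U = u ` {l<..l + m}"
  have U: "finite U" "card U = m" "orthonormal_set U" "U \<subseteq> tail l" "sum qf U = of_nat m"
    using orthonormal_set_u[of l "l + m"] card_u[of l "l + m"] sum_qf_u[of l "l + m"]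
    by (auto simp: U_def tail_def intro: complex_vector.span_base)
  note UV = orthonormal_set_Un_tail[OF V(3) U(3) l(2) U(4)]
  define \<sigma> where "\<sigma> = sum qf V"
  have "Re (qf v) \<le> - b / 2" if "v \<in> V" for v
    using V(5)[OF that] abs_Re_le_cmod[of "qf v + of_real b"]
    by (simp add: \<epsilon>_def abs_le_iff del: mult_minus_left)
  then have "Re \<sigma> \<le> of_nat (card V) * (- b / 2)"
    unfolding \<sigma>_def Re_sum by (rule sum_bounded_above)
  then have Re_\<sigma>: "Re \<sigma> \<le> - K - \<bar>\<tau>\<bar>" using m(2) V(2) by simp
  have "\<bar>Im (qf v)\<bar> \<le> \<delta> / (m + 1)" if "v \<in> V" for v
    using V(5)[OF that] abs_Im_le_cmod[of "qf v + of_real b"] by (simp add: \<epsilon>_def)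
  then have "(\<Sum>v\<in>V. \<bar>Im (qf v)\<bar>) \<le> of_nat (card V) * (\<delta> / (m + 1))"
    by (rule sum_bounded_above)
  then have "\<bar>Im \<sigma>\<bar> \<le> m * (\<delta> / (m + 1))"
    unfolding \<sigma>_def Im_sum V(2) by (rule order_trans[OF sum_abs])
  also have "\<dots> \<le> \<delta>" using \<delta> by (simp add: field_simps)
  finally have Im_\<sigma>: "\<bar>Im \<sigma>\<bar> \<le> \<delta>" .
  have "Im (qf w1) < 0 \<and> 0 < Im (qf w2) \<and> \<bar>Im \<sigma>\<bar> \<le> - Im (qf w1) \<and> \<bar>Im \<sigma>\<bar> \<le> Im (qf w2)
      \<or> Im (qf w1) = 0 \<and> Im (qf w2) = 0 \<and> Im \<sigma> = 0"
  proof (cases "Im (qf w1) < 0 \<and> 0 < Im (qf w2)")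
    case True
    then show ?thesis using Im_\<sigma> by (simp add: \<delta>_def)
  next
    case False
    then have 0: "\<And>x. x \<in> tail n \<Longrightarrow> Im (qf x) = 0" using im by blast
    have "Im \<sigma> = 0"
      unfolding \<sigma>_def Im_sum
      by (rule sum.neutral) (use V(4) tail_mono[OF k(1)] 0 in blast)
    then show ?thesis using 0 w by simp
  qed
  from solve_mixture[OF _ _ m(1) Re_\<sigma> this]
  obtain s r where sr: "0 \<le> s" "s \<le> 1" "0 \<le> r" "r \<le> 1"
    "of_real (1 - s) * qf w1 + of_real s * qf w2 + (of_real (1 - r) * of_nat m + of_real r * \<sigma>)
      = complex_of_real \<tau>"
    by (auto simp: K_def)
  obtain w where w': "cinner w w = 1" "w \<in> cspan {w1, w2}"
    "qf w = of_real (1 - s) * qf w1 + of_real s * qf w2"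
    using qf_segment[OF w(3-5) sr(1,2)] by (metis complex_vector.span_base insertI1)
  obtain C where C: "finite C" "orthonormal_set C" "C \<subseteq> cspan (U \<union> V)"
    "sum qf C = of_real (1 - r) * sum qf U + of_real r * sum qf V"
    using ex_orthonormal_mixture[of U V r] U V UV sr by (auto simp: Un_commute Int_commute)
  have "cspan (U \<union> V) \<subseteq> tail k"
    using U(4) V(4) tail_mono[OF l(1)] unfolding tail_def
    by (intro complex_vector.span_minimal) auto
  then have "C \<subseteq> tail k" using C(3) by blast
  moreover have "{w} \<subseteq> cspan (u ` {n<..k})"
    using w'(2) complex_vector.span_minimal[OF k(2)] by auto
  ultimately have un: "orthonormal_set ({w} \<union> C)" "{w} \<inter> C = {}"
    using orthonormal_set_Un_tail[of "{w}" C n k] C(2) w'(1) by (auto simp: orthonormal_set_def)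
  have "w \<in> tail n"
    using w'(2) w(1,2) complex_vector.span_minimal[of "{w1, w2}" "tail n"] by (auto simp: tail_def)
  then have "{w} \<union> C \<subseteq> tail n"
    using \<open>C \<subseteq> tail k\<close> tail_mono[OF k(1)] by blast
  moreover have "sum qf ({w} \<union> C) = of_real \<tau>"
    using un(2) C(1,4) w'(3) U(5) sr(5) by (simp add: \<sigma>_def)
  ultimately show ?thesis using un(1) C(1) by (intro exI[of _ "{w} \<union> C"]) blast
qed

text \<open>Complete \<open>A\<close> by \<open>R\<close> to a basis of the span of the first
  \<open>k\<close> vectors \<open>u i\<close>. That span has trace \<open>k\<close>, and
  \<open>A\<close> contributes nothing, so \<open>R\<close> carries all of it. A set
  \<open>V\<close> of trace \<open>- k\<close> from the tail cancels it, and
  \<open>R \<union> V\<close> is rotated to zero diagonal while \<open>A\<close> stays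
  fixed.\<close>

lemma extend_zero_diagonal:
  assumes A: "finite A" "orthonormal_set A" "A \<subseteq> tail 0" "\<forall>a\<in>A. qf a = 0"
  shows "\<exists>B. finite B \<and> orthonormal_set B \<and> B \<subseteq> tail 0 \<and> (\<forall>b\<in>B. qf b = 0) \<and>
    A \<subset> B \<and> u ` {0<..n} \<subseteq> cspan B"
proof -
  obtain k where k: "k \<ge> n" "A \<subseteq> cspan (u ` {0<..k})"
    using finite_subset_span_cutoff[OF A(1)] A(3) unfolding tail_def by blast
  obtain R where R: "finite R" "A \<inter> R = {}" "orthonormal_set (A \<union> R)"
    "cspan (A \<union> R) = cspan (A \<union> u ` {0<..k})"
    using orthonormal_completion[OF A(1,2), of "u ` {0<..k}"] by auto
  have "A \<union> u ` {0<..k} \<subseteq> cspan (u ` {0<..k})"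
    using k(2) by (auto intro: complex_vector.span_base)
  then have spanR: "cspan (A \<union> R) = cspan (u ` {0<..k})"
    unfolding R(4) by (intro equalityI complex_vector.span_minimal complex_vector.span_mono) auto
  have "sum qf (A \<union> R) = of_nat k"
    using qf_sum_span_cong[OF _ R(3) _ orthonormal_set_u spanR] A(1) R(1) sum_qf_u[of 0 k] by simp
  then have sumR: "sum qf R = of_nat k"
    using A(1,4) R(1,2) by (simp add: sum.union_disjoint)
  obtain V where V: "finite V" "V \<noteq> {}" "orthonormal_set V" "V \<subseteq> tail k"
    "sum qf V = of_real (- real k)"
    using ex_tail_set_sum by blast
  have sub: "A \<union> R \<subseteq> cspan (u ` {0<..k})"
    using complex_vector.span_superset[of "A \<union> R"] unfolding spanR .
  note AV = orthonormal_set_Un_tail[OF R(3) V(3) sub V(4)]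
  have "sum qf (R \<union> V) = 0"
    using AV(2) R(1) V(1,5) sumR by (subst sum.union_disjoint) auto
  moreover have "orthonormal_set (R \<union> V)"
    using AV(1) by (rule orthonormal_set_subset) auto
  ultimately obtain B where B: "finite B" "orthonormal_set B" "cspan B = cspan (R \<union> V)"
    "\<forall>b\<in>B. qf b = 0"
    using ex_orthonormal_zero_diagonal[of "R \<union> V"] R(1) V(1) by auto
  have orth: "cinner a c = 0" if "a \<in> A" "c \<in> R \<union> V" for a c
    using that AV R(2) by (auto simp: orthonormal_set_def)
  have AB: "orthonormal_set (A \<union> B)"
    using orthonormal_set_Un_span(1)[OF A(2) B(2) complex_vector.span_superset _ orth] B(3)
      complex_vector.span_superset by blast
  have span: "cspan (A \<union> B) = cspan (A \<union> R \<union> V)"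
    using cspan_Un_cong[OF B(3), of A] by (simp add: Un_ac)
  have "cspan (u ` {0<..k}) \<subseteq> tail 0"
    unfolding tail_def by (intro complex_vector.span_mono) auto
  then have "A \<union> R \<union> V \<subseteq> tail 0"
    using sub V(4) tail_mono[of 0 k] by auto
  then have "A \<union> B \<subseteq> tail 0"
    using span complex_vector.span_superset[of "A \<union> B"]
      complex_vector.span_minimal[of "A \<union> R \<union> V" "tail 0"] unfolding tail_def by blast
  moreover have "u ` {0<..n} \<subseteq> cspan (A \<union> B)"
  proof -
    have "u ` {0<..n} \<subseteq> cspan (u ` {0<..k})"
      using k(1) by (auto intro!: complex_vector.span_base)
    also have "\<dots> \<subseteq> cspan (A \<union> B)"
      unfolding span spanR[symmetric] by (intro complex_vector.span_mono) auto
    finally show ?thesis .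
  qed
  \<comment> \<open>The nonempty \<open>V\<close> lies in the span of \<open>B\<close> and is
    orthogonal to \<open>A\<close>, so the extension is strict even if \<open>R\<close> is
    empty.\<close>
  moreover have "\<not> B \<subseteq> A"
  proof
    assume "B \<subseteq> A"
    obtain v where v: "v \<in> V" using V(2) by blast
    have "v \<in> cspan B" unfolding B(3) using v by (intro complex_vector.span_base) simp
    then have "v \<in> cspan A" using complex_vector.span_mono[OF \<open>B \<subseteq> A\<close>] by blast
    then have "cinner v v = 0"
      using orth v by (auto intro: cinner_span_left_eq_0)
    then show False using V(3) v by (simp add: orthonormal_set_def)
  qed
  ultimately show ?thesis
    using A(1,4) B(1,4) AB by (intro exI[of _ "A \<union> B"]) auto
qed

lemma ex_zero_diagonal_basis:
  "\<exists>v. orthonormal_basis {1..} v \<and> (\<forall>j\<ge>1. qf (v j) = 0)"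
proof -
  define P where "P A \<longleftrightarrow> finite A \<and> orthonormal_set A \<and> A \<subseteq> tail 0 \<and> (\<forall>a\<in>A. qf a = 0)" for A
  \<comment> \<open>Step \<open>n\<close> absorbs the first \<open>n\<close> basis vectors, so the
    spans of the growing sets exhaust the span of \<open>u\<close>.\<close>
  have "\<exists>A. \<forall>n. P (A n) \<and> (A n \<subset> A (Suc n) \<and> u ` {0<..n} \<subseteq> cspan (A (Suc n)))"
  proof (rule dependent_nat_choice)
    show "\<exists>A. P A" by (rule exI[of _ "{}"]) (simp add: P_def)
    fix A n assume "P A"
    then show "\<exists>B. P B \<and> (A \<subset> B \<and> u ` {0<..n} \<subseteq> cspan B)"
      using extend_zero_diagonal[of A n] unfolding P_def by simp
  qed
  then obtain A where
    A': "\<forall>n. P (A n) \<and> (A n \<subset> A (Suc n) \<and> u ` {0<..n} \<subseteq> cspan (A (Suc n)))" ..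
  have A: "P (A n)" "A n \<subset> A (Suc n) \<and> u ` {0<..n} \<subseteq> cspan (A (Suc n))" for n
    using A'[rule_format, of n] by (rule conjunct1, rule conjunct2)
  define B where "B = (\<Union>n. A n)"
  have mono: "A m \<subseteq> A n" if "m \<le> n" for m n
    by (rule lift_Suc_mono_le[OF _ that]) (use A(2) in blast)
  have on: "orthonormal_set B"
    unfolding orthonormal_set_def
  proof (intro ballI)
    fix x y assume "x \<in> B" "y \<in> B"
    then obtain m n where "x \<in> A m" "y \<in> A n" by (auto simp: B_def)
    then have "x \<in> A (max m n)" "y \<in> A (max m n)" using mono[of m "max m n"] mono[of n "max m n"] by auto
    then show "cinner x y = (if x = y then 1 else 0)"
      using A(1)[of "max m n"] by (simp add: P_def orthonormal_set_def)
  qed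
  \<comment> \<open>Strict growth makes the union infinite, as an enumeration by all natural numbers
    requires.\<close>
  have card: "n \<le> card (A n)" for n
  proof (induction n)
    case (Suc n)
    have "card (A n) < card (A (Suc n))"
      using A(1)[of "Suc n"] A(2)[of n] by (intro psubset_card_mono) (auto simp: P_def)
    then show ?case using Suc by simp
  qed simp
  have inf: "infinite B"
  proof
    assume "finite B"
    then have "card (A (Suc (card B))) \<le> card B" by (intro card_mono) (auto simp: B_def)
    then show False using card[of "Suc (card B)"] by simp
  qed
  have "countable B"
    using A(1) unfolding B_def P_def by (intro countable_UN) (auto intro: countable_finite)
  then have bij: "bij_betw (from_nat_into B) UNIV B"
    using inf by (rule bij_betw_from_nat_into)
  \<comment> \<open>Bases are indexed from 1. Truncated subtraction repeats the first vector at
    index 0, outside the index set.\<close>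
  define v where "v j = from_nat_into B (j - 1)" for j
  have v: "v ` {1..} = B"
  proof -
    have "(\<lambda>j. j - 1) ` {1..} = (UNIV :: nat set)"
    proof (intro set_eqI iffI UNIV_I)
      show "n \<in> (\<lambda>j. j - 1) ` {1..}" for n :: nat
        by (rule image_eqI[of _ _ "Suc n"]) auto
    qed
    then show ?thesis using bij unfolding bij_betw_def v_def[abs_def]
      by (metis image_image)
  qed
  have inj: "v i = v j \<longleftrightarrow> i = j" if "i \<in> {1..}" "j \<in> {1..}" for i j
    using that bij by (auto simp: v_def bij_betw_def inj_eq)
  have fam: "orthonormal_family {1..} v"
    unfolding orthonormal_family_def using on inj v unfolding orthonormal_set_def
    by (metis (no_types, lifting) imageI)
  have "u ` {0<..} \<subseteq> cspan B"
  proof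
    fix y assume "y \<in> u ` {0<..}"
    then obtain n where "y = u n" "0 < n" by auto
    then have "y \<in> u ` {0<..n}" by simp
    then have "y \<in> cspan (A (Suc n))" using A(2) by blast
    then show "y \<in> cspan B"
      using complex_vector.span_mono[of "A (Suc n)" B] by (auto simp: B_def)
  qed
  then have "cspan (u ` {0<..}) \<subseteq> cspan B"
    by (intro complex_vector.span_minimal) auto
  then have "closure (cspan B) = UNIV"
    using u closure_mono unfolding orthonormal_basis_def by blast
  then have "orthonormal_basis {1..} v"
    using fam v by (simp add: orthonormal_basis_def)
  moreover have "qf (v j) = 0" if "j \<ge> 1" for j
  proof -
    have "v j \<in> B" using v that by auto
    then show ?thesis using A(1) by (auto simp: B_def P_def)
  qed
  ultimately show ?thesis by blast
qed

end

section \<open>Constant diagonals\<close>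

lemma bounded_clinear_affine:
  assumes "bounded_clinear T"
  shows "bounded_clinear (\<lambda>x. c *\<^sub>C (T x - l *\<^sub>C x))"
proof -
  have sc: "bounded_linear (\<lambda>x::'a. d *\<^sub>C x)" for d
    by (rule bounded_linear_intro[where K = "cmod d"])
      (simp_all add: scaleC_add_right scaleR_scaleC scaleC_scaleC norm_scaleC mult.commute)
  have "bounded_linear (\<lambda>x. c *\<^sub>C (T x - l *\<^sub>C x))"
    using assms unfolding bounded_clinear_def
    by (intro bounded_linear_compose[OF sc] bounded_linear_sub sc) blast
  then show ?thesis
    using assms unfolding bounded_clinear_def
    by (simp add: scaleC_scaleC mult.commute complex_vector.scale_right_diff_distrib)
qed

lemma D_const_infinite_dim:
  fixes T :: "'a::chilbert_space \<Rightarrow> 'a"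
  assumes "hdim TYPE('a) = \<infinity>"
  shows "D_const T = {l. \<exists>u. orthonormal_basis {1..} u \<and> (\<forall>j\<ge>1. cinner (T (u j)) (u j) = l)}"
  using assms by (simp add: D_const_def atLeast_def)

text \<open>A basis with constant diagonal is an orthonormal sequence with constant values; thus any
  two points of \<open>D_const T\<close> can serve as the ends of the segment below.\<close>

lemma D_const_subset_W_ess:
  fixes T :: "'a::chilbert_space \<Rightarrow> 'a"
  assumes "hdim TYPE('a) = \<infinity>"
  shows "D_const T \<subseteq> W_ess T"
proof
  fix l assume "l \<in> D_const T"
  then obtain u where u: "orthonormal_basis {1..} u" "\<forall>j\<ge>1. cinner (T (u j)) (u j) = l"
    using D_const_infinite_dim[OF assms] by blast
  have "\<forall>\<^sub>F j in sequentially. cinner (T (u j)) (u j) = l"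
    using eventually_ge_at_top[of 1] by eventually_elim (use u in simp)
  then have "(\<lambda>j. cinner (T (u j)) (u j)) \<longlonglongrightarrow> l" by (rule tendsto_eventually)
  then show "l \<in> W_ess T"
    using u(1) by (auto simp: W_ess_def orthonormal_basis_def)
qed

lemma D_const_segment:
  fixes T :: "'a::chilbert_space \<Rightarrow> 'a"
  assumes inf: "hdim TYPE('a) = \<infinity>" and T: "bounded_clinear T"
    and \<alpha>: "\<alpha> \<in> D_const T" and \<beta>: "\<beta> \<in> W_ess T" and t: "0 < t" "t < 1"
  shows "complex_of_real t * \<alpha> + (1 - complex_of_real t) * \<beta> \<in> D_const T"
proof (cases "\<alpha> = \<beta>")
  \<comment> \<open>The normalisation below divides by \<open>\<alpha> - l\<close>, which would be
    zero here.\<close>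
  case True
  then show ?thesis using \<alpha> by (simp add: algebra_simps)
next
  case False
  define l where "l = complex_of_real t * \<alpha> + (1 - complex_of_real t) * \<beta>"
  have "\<alpha> - l = (1 - of_real t) * (\<alpha> - \<beta>)"
    by (simp add: l_def algebra_simps)
  moreover have "1 - complex_of_real t \<noteq> 0" using t by (metis of_real_1 eq_iff_diff_eq_0 of_real_eq_iff less_irrefl)
  ultimately have \<alpha>l: "\<alpha> \<noteq> l" using False by auto
  \<comment> \<open>The map taking \<open>z\<close> to \<open>c * (z - l)\<close> sends the target
    \<open>l\<close> to 0 and \<open>\<alpha>\<close> to 1.\<close>
  define c where "c = 1 / (\<alpha> - l)"
  have c: "c * (\<alpha> - l) = 1" using \<alpha>l by (simp add: c_def)
  \<comment> \<open>The differences \<open>\<alpha> - l\<close> and \<open>\<beta> - l\<close> are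
    \<open>1 - t\<close> and \<open>- t\<close> times \<open>\<alpha> - \<beta>\<close>, so
    \<open>\<beta>\<close> is sent to \<open>- b\<close>.\<close>
  define b where "b = t / (1 - t)"
  have "\<beta> - l = of_real t * (\<beta> - \<alpha>)" by (simp add: l_def algebra_simps)
  then have "(1 - of_real t) * (\<beta> - l) = - of_real t * (\<alpha> - l)"
    unfolding \<open>\<alpha> - l = _\<close> by (simp add: algebra_simps)
  then have "(1 - of_real t) * (c * (\<beta> - l)) = - complex_of_real t"
    using c by (simp add: mult.left_commute)
  then have c\<beta>: "c * (\<beta> - l) = - of_real b"
    using \<open>1 - complex_of_real t \<noteq> 0\<close> by (simp add: b_def field_simps)
  define S where "S x = c *\<^sub>C (T x - l *\<^sub>C x)" for x
  interpret S: bounded_operator S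
    unfolding S_def[abs_def] by standard (rule bounded_clinear_affine[OF T])
  have qf_S: "S.qf x = c * (cinner (T x) x - l)" if "cinner x x = 1" for x
    using that by (simp add: S.qf_def S_def cinner_scaleC_left cinner_diff_left)
  obtain u where u: "orthonormal_basis {1..} u" "\<And>j. j \<ge> 1 \<Longrightarrow> cinner (T (u j)) (u j) = \<alpha>"
    using \<alpha> D_const_infinite_dim[OF inf] by blast
  obtain x where x: "orthonormal_family {1..} x" "(\<lambda>j. cinner (T (x j)) (x j)) \<longlonglongrightarrow> \<beta>"
    using \<beta> by (auto simp: W_ess_def)
  have pos: "{0<..} = {1::nat..}" by auto
  interpret S: unit_diagonal_operator S u x b
  proof
    show "orthonormal_basis {0<..} u" using u(1) by (simp only: pos)
    show "S.qf (u j) = 1" if "0 < j" for j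
      using that u qf_S[of "u j"] c by (simp add: orthonormal_basis_def orthonormal_family_def)
    show "orthonormal_family {1..} x" by fact
    have "\<forall>\<^sub>F j in sequentially. c * (cinner (T (x j)) (x j) - l) = S.qf (x j)"
      using eventually_ge_at_top[of 1]
      by eventually_elim (use x(1) qf_S in \<open>simp add: orthonormal_family_def\<close>)
    moreover have "(\<lambda>j. c * (cinner (T (x j)) (x j) - l)) \<longlonglongrightarrow> c * (\<beta> - l)"
      by (intro tendsto_intros x(2))
    ultimately show "(\<lambda>j. S.qf (x j)) \<longlonglongrightarrow> - of_real b"
      unfolding c\<beta> by (rule Lim_transform_eventually[rotated])
    show "0 < b" using t by (simp add: b_def)
  qed
  obtain v where v: "orthonormal_basis {1..} v" "\<And>j. j \<ge> 1 \<Longrightarrow> S.qf (v j) = 0"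
    using S.ex_zero_diagonal_basis by blast
  have "cinner (T (v j)) (v j) = l" if "j \<ge> 1" for j
    using v(2)[OF that] qf_S[of "v j"] v(1) that c
    by (auto simp: orthonormal_basis_def orthonormal_family_def)
  then show ?thesis
    using v(1) D_const_infinite_dim[OF inf] by (auto simp: l_def)
qed

text \<open>A basis with constant diagonal \<open>l\<close> gives the trace \<open>n * l\<close>,
  and the trace does not depend on the basis.\<close>

lemma D_const_finite_dim_unique:
  fixes T :: "'a::chilbert_space \<Rightarrow> 'a"
  assumes "hdim TYPE('a) = enat n" "n \<ge> 1" and T: "bounded_clinear T"
    and "\<alpha> \<in> D_const T" "\<beta> \<in> D_const T"
  shows "\<alpha> = \<beta>"
proof -
  interpret bounded_operator T by standard (rule T)
  have "\<exists>A::'a set. finite A \<and> orthonormal_set A \<and> cspan A = UNIV \<and> sum qf A = of_nat n * l"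
    if l: "l \<in> D_const T" for l
  proof -
    have "{j. 1 \<le> j \<and> enat j \<le> hdim TYPE('a)} = {1..n}" using assms(1) by auto
    moreover obtain u where "orthonormal_basis {j. 1 \<le> j \<and> enat j \<le> hdim TYPE('a)} u"
      "\<forall>j\<in>{j. 1 \<le> j \<and> enat j \<le> hdim TYPE('a)}. qf (u j) = l"
      using l unfolding D_const_def qf_def by blast
    ultimately have u: "orthonormal_basis {1..n} u" "\<forall>j\<in>{1..n}. qf (u j) = l"
      by simp_all
    then have on: "orthonormal_family {1..n} u" by (simp add: orthonormal_basis_def)
    note on = orthonormal_family_image[OF on]
    have "sum qf (u ` {1..n}) = (\<Sum>a\<in>u ` {1..n}. l)"
      using u(2) by (intro sum.cong) auto
    then have "sum qf (u ` {1..n}) = of_nat n * l"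
      using card_image[OF on(2)] by simp
    \<comment> \<open>Comparing traces needs equal algebraic spans, so the closure in the definition
      of a basis has to be removed.\<close>
    moreover have "cspan (u ` {1..n}) = UNIV"
      using u(1) on(1) by (intro orthonormal_dense_span) (auto simp: orthonormal_basis_def)
    ultimately show ?thesis using on(1) by blast
  qed
  from this[OF assms(4)] this[OF assms(5)] have "of_nat n * \<alpha> = of_nat n * \<beta>"
    using qf_sum_span_cong by metis
  then show ?thesis using assms(2) by simp
qed

theorem theorem3p9:
  fixes T :: "'a::chilbert_space \<Rightarrow> 'a"
  assumes "separable_space (euclidean :: 'a topology)"
    and "1 \<le> hdim TYPE('a)"
    and "bounded_clinear T"
  shows "(hdim TYPE('a) = \<infinity> \<longrightarrow>
           (\<forall>\<alpha>\<in>D_const T. \<forall>\<beta>\<in>W_ess T. \<forall>t::real. 0 < t \<and> t < 1 \<longrightarrow>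
              complex_of_real t * \<alpha> + (1 - complex_of_real t) * \<beta> \<in> D_const T))
         \<and> convex (D_const T)"
proof (intro conjI impI ballI allI)
  fix \<alpha> \<beta> t
  assume "hdim TYPE('a) = \<infinity>" "\<alpha> \<in> D_const T" "\<beta> \<in> W_ess T" "0 < t \<and> t < (1::real)"
  then show "complex_of_real t * \<alpha> + (1 - complex_of_real t) * \<beta> \<in> D_const T"
    using D_const_segment assms(3) by blast
next
  show "convex (D_const T)"
  proof (cases "hdim TYPE('a)")
    case (enat n)
    then have "n \<ge> 1" using assms(2) by (simp add: one_enat_def)
    then have "D_const T \<subseteq> {\<alpha>}" if "\<alpha> \<in> D_const T" for \<alpha>
      using D_const_finite_dim_unique[OF enat _ assms(3)] that by blast
    then have "D_const T = {} \<or> (\<exists>\<alpha>. D_const T = {\<alpha>})" by blast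
    then show ?thesis by auto
  next
    case infinity
    show ?thesis
      unfolding convex_alt
    proof (intro ballI allI impI)
      fix \<beta> \<alpha> and t :: real
      assume *: "\<beta> \<in> D_const T" "\<alpha> \<in> D_const T" "0 \<le> t \<and> t \<le> 1"
      \<comment> \<open>The segment lemma covers the open interval; at the ends the combination is
        one of the given points.\<close>
      then consider "t = 0" | "t = 1" | "0 < t" "t < 1" by linarith
      then show "(1 - t) *\<^sub>R \<beta> + t *\<^sub>R \<alpha> \<in> D_const T"
      proof cases
        case 3
        then have "complex_of_real t * \<alpha> + (1 - complex_of_real t) * \<beta> \<in> D_const T"
          using D_const_segment[OF infinity assms(3)] D_const_subset_W_ess[OF infinity] * by blast
        then show ?thesis by (simp add: scaleR_conv_of_real add.commute)
      qed (use * in simp_all)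
    qed
  qed
qed

end
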